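(* For every integer $n\ge 3$, there exists an $n$-good rational map $R(z)=\sum_{j=1}^n\frac{a_j}{z-p_j}$ which has only positive residues (all $a_j$ real and positive) and which is not a rational Ahlfors function, i.e. $R$ is not the Ahlfors function on $R^{-1}(\mathbb{D})$.
   Context: $\widehat{\mathbb{C}}$ is the Riemann sphere and $\mathbb{D}=\{z\in\mathbb{C}:|z|<1\}$ is the open unit disk. For a rational map $R$, $R^{-1}(\mathbb{D})=\{z\in\widehat{\mathbb{C}}:|R(z)|<1\}$. Ahlfors function: let $X\subset\widehat{\mathbb{C}}$ be a domain containing $\infty$. For holomorphic $f:X\to\mathbb{C}$, put $f'(\infty):=\lim_{z\to\infty}z(f(z)-f(\infty))$. The Ahlfors function on $X$ is the unique function maximizing $\mathrm{Re}\,f'(\infty)$ among all holomorphic $f:X\to\mathbb{D}$ with $f(\infty)=0$. A rational map $R$ of degree $n$ is called $n$-good if $R(\infty)=0$, $R^{-1}(\mathbb{D})$ is connected, and $R^{-1}(\widehat{\mathbb{C}}\setminus\mathbb{D})$ has exactly $n$ connected components. Every $n$-good rational map has only simple poles, all in $\mathbb{C}$, and so can be written as $R(z)=\sum_{j=1}^n\frac{a_j}{z-p_j}$ with $a_j\in\mathbb{C}\setminus\{0\}$ and distinct $p_j\in\mathbb{C}$. A rational Ahlfors function (of degree $n$) is an $n$-good rational map $R$ whose restriction to $R^{-1}(\mathbb{D})$ is the Ahlfors function on $R^{-1}(\mathbb{D})$. *)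

theory Defs
  imports
    "HOL-Analysis.Analysis"
    "HOL-Computational_Algebra.Computational_Algebra"
begin

text \<open>
  Points of the Riemann sphere are elements of \<^typ>\<open>complex option\<close>, where \<^term>\<open>None\<close> is the
  point at infinity.
\<close>

abbreviation riemann_sphere :: "complex option topology" where
  "riemann_sphere \<equiv> Alexandroff_compactification euclidean"

text \<open>The value at infinity is the limit of \<open>p(z)/q(z)\<close>; it is finite iff \<open>deg p \<le> deg q\<close>.\<close>

definition rational_eval ::
    "complex poly \<Rightarrow> complex poly \<Rightarrow> complex option \<Rightarrow> complex option" where
  "rational_eval p q x =
     (case x of
        Some z \<Rightarrow> (if poly q z = 0 then None else Some (poly p z / poly q z))
      | None \<Rightarrow> (if degree p > degree q then None
                 else Some (coeff p (degree q) / lead_coeff q)))"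

definition rational_map :: "nat \<Rightarrow> (complex option \<Rightarrow> complex option) \<Rightarrow> bool" where
  "rational_map n R \<longleftrightarrow>
     (\<exists>p q. q \<noteq> 0 \<and> coprime p q \<and> max (degree p) (degree q) = n \<and> R = rational_eval p q)"

text \<open>The inverse of the chart \<open>z \<mapsto> 1/z\<close> around infinity.\<close>

definition chart_inf :: "complex \<Rightarrow> complex option" where
  "chart_inf w = (if w = 0 then None else Some (inverse w))"

text \<open>To be used for open \<open>X\<close> only.\<close>

definition sphere_holomorphic_on ::
    "(complex option \<Rightarrow> complex) \<Rightarrow> complex option set \<Rightarrow> bool" where
  "sphere_holomorphic_on f X \<longleftrightarrow>
     (f \<circ> Some) holomorphic_on (Some -` X) \<and>
     (f \<circ> chart_inf) holomorphic_on (chart_inf -` X)"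

definition deriv_inf :: "(complex option \<Rightarrow> complex) \<Rightarrow> complex" where
  "deriv_inf f = Lim at_infinity (\<lambda>z. z * (f (Some z) - f None))"

definition ahlfors_admissible ::
    "complex option set \<Rightarrow> (complex option \<Rightarrow> complex) \<Rightarrow> bool" where
  "ahlfors_admissible X f \<longleftrightarrow>
     sphere_holomorphic_on f X \<and> (\<forall>x\<in>X. norm (f x) < 1) \<and> f None = 0"

text \<open>
  To be used for domains \<open>X\<close> of the sphere that contain infinity only. On such a domain the maximizer
  is unique as a function on \<open>X\<close>, so a maximizer is the Ahlfors function. Values of \<open>f\<close> outside
  \<open>X\<close> are irrelevant.
\<close>

definition ahlfors_function ::
    "complex option set \<Rightarrow> (complex option \<Rightarrow> complex) \<Rightarrow> bool" where
  "ahlfors_function X f \<longleftrightarrow>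
     ahlfors_admissible X f \<and>
     (\<forall>g. ahlfors_admissible X g \<longrightarrow> Re (deriv_inf g) \<le> Re (deriv_inf f))"

abbreviation sphere_disk :: "complex option set" where
  "sphere_disk \<equiv> Some ` ball 0 1"

definition n_good :: "nat \<Rightarrow> (complex option \<Rightarrow> complex option) \<Rightarrow> bool" where
  "n_good n R \<longleftrightarrow>
     rational_map n R \<and>
     R None = Some 0 \<and>
     connectedin riemann_sphere (R -` sphere_disk) \<and>
     finite (connected_components_of (subtopology riemann_sphere (R -` (- sphere_disk)))) \<and>
     card (connected_components_of (subtopology riemann_sphere (R -` (- sphere_disk)))) = n"

text \<open>
  On \<open>R\<^sup>-\<^sup>1(\<D>)\<close> the map \<open>R\<close> takes finite values only, so \<^term>\<open>the \<circ> R\<close> is the restriction of \<open>R\<close>,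
  viewed as complex-valued.
\<close>

definition rational_ahlfors_function ::
    "nat \<Rightarrow> (complex option \<Rightarrow> complex option) \<Rightarrow> bool" where
  "rational_ahlfors_function n R \<longleftrightarrow>
     n_good n R \<and> ahlfors_function (R -` sphere_disk) (the \<circ> R)"

end

theory Submission
  imports Defs "HOL-Complex_Analysis.Complex_Analysis"
begin

text \<open>
  Let \<open>R = \<epsilon> * (\<Sum>j. 1 / (z - p j))\<close> with \<open>\<epsilon>\<close> small. The set \<open>\<bar>R\<bar> \<ge> 1\<close> splits into \<open>n\<close> small starlike pieces around the
  poles, so \<open>R\<close> is \<open>n\<close>-good. A competitor \<open>R + \<delta> * h\<close> with \<open>h\<close> holomorphic off the poles and \<open>h = 0\<close> at infinity is
  admissible for small \<open>\<delta> > 0\<close> as soon as \<open>Re (h * cnj R) < 0\<close> on \<open>\<bar>R\<bar> = 1\<close>, by the maximum principle, and it beats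
  \<open>R\<close> if moreover the residues of \<open>h\<close> have positive real sum. To leading order in \<open>\<epsilon>\<close> positivity of the residues
  of \<open>R\<close> excludes such \<open>h\<close>, and purely imaginary residues \<open>b j\<close> are neutral. Expanding to
  second order, the mean of \<open>Re (h * cnj R)\<close> on the \<open>j\<close>-th boundary curve is shifted by an amount whose sum over \<open>j\<close> is
  a multiple of \<open>\<Sum>j\<noteq>i. \<Sum>k\<noteq>j. b i / \<i> * Im (1 / ((p j - p k) * cnj (p j - p i)))\<close>. This is nonzero for suitable
  non-collinear poles, and then, replacing \<open>b\<close> by \<open>- b\<close> if necessary, real residue corrections of order \<open>\<epsilon>\<^sup>2\<close>
  yield such an \<open>h\<close>.
\<close>

section \<open>Connectedness in the plane and on the sphere\<close>

text \<open>A starlike set is contractible, hence homotopy equivalent to a point, and homotopy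
  equivalent compact sets agree on whether they separate the plane.\<close>

lemma connected_Compl_starlike:
  fixes K :: "complex set"
  assumes "compact K" "starlike K"
  shows "connected (- K)"
proof -
  obtain a where "a \<in> K"
    using assms(2) unfolding starlike_def by blast
  have "K homotopy_eqv {a}"
    using assms(2) \<open>a \<in> K\<close> starlike_imp_contractible homotopy_eqv_sing by blast
  then have "connected (- K) \<longleftrightarrow> connected (- {a})"
    using assms(1) by (intro homotopy_eqv_separation) auto
  then show ?thesis
    by (simp add: connected_punctured_universe)
qed

text \<open>By Janiszewski's theorem, adding one more piece cannot separate the plane, because its
  intersection with the earlier pieces is empty and hence connected.\<close>

lemma connected_Compl_Union_disjoint:
  fixes K :: "'i \<Rightarrow> complex set"
  assumes "finite I" "\<And>i. i \<in> I \<Longrightarrow> compact (K i)" "\<And>i. i \<in> I \<Longrightarrow> connected (- K i)"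
    and "disjoint_family_on K I"
  shows "connected (- (\<Union>i\<in>I. K i))"
  using assms
proof (induction I rule: finite_induct)
  case empty
  then show ?case by (simp add: convex_connected)
next
  case (insert i I)
  have dis: "K i \<inter> (\<Union>i\<in>I. K i) = {}"
    using insert.prems(3) insert.hyps(2) by (fastforce dest: disjoint_family_onD)
  have "connected (- (K i \<union> (\<Union>i\<in>I. K i)))"
  proof (rule Janiszewski_connected)
    show "closed (\<Union>i\<in>I. K i)"
      using insert by (intro closed_UN) (auto intro: compact_imp_closed)
    show "connected (- (\<Union>i\<in>I. K i))"
      using insert by (intro insert.IH) (auto simp: disjoint_family_on_def)
  qed (use insert.prems dis in auto)
  then show ?case by simp
qed

lemma connectedin_sphere_image_Some:
  "connected S \<Longrightarrow> connectedin riemann_sphere (Some ` S)"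
  by (rule connectedin_continuous_map_image[OF continuous_map_Some]) simp

text \<open>Neighbourhoods of infinity are complements of compact sets, so an unbounded set has
  infinity in its closure, and adding closure points preserves connectedness.\<close>

lemma connectedin_sphere_insert_None:
  fixes S :: "complex set"
  assumes "connected S" "\<not> bounded S"
  shows "connectedin riemann_sphere (insert None (Some ` S))"
proof (rule connectedin_intermediate_closure_of)
  show "connectedin riemann_sphere (Some ` S)"
    using assms by (intro connectedin_sphere_image_Some)
  have "None \<in> riemann_sphere closure_of (Some ` S)"
    unfolding in_closure_of
  proof safe
    show "None \<in> topspace riemann_sphere" by simp
    fix T assume T: "None \<in> T" "openin riemann_sphere T"
    then obtain C :: "complex set" where C: "compact C" "T = insert None (Some ` (- C))"
      unfolding openin_Alexandroff_compactification by (auto simp: Compl_eq_Diff_UNIV)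
    then have "\<not> S \<subseteq> C"
      using assms(2) bounded_subset compact_imp_bounded by blast
    then obtain z where "z \<in> S" "z \<notin> C"
      by blast
    then show "\<exists>y. y \<in> Some ` S \<and> y \<in> T"
      unfolding C by (intro exI[of _ "Some z"]) simp
  qed
  moreover have "Some ` S \<subseteq> riemann_sphere closure_of (Some ` S)"
    by (rule closure_of_subset) auto
  ultimately show "insert None (Some ` S) \<subseteq> riemann_sphere closure_of (Some ` S)"
    by blast
qed auto

text \<open>The complement of each piece is a finite union of closed pieces, so every piece is
  clopen. A component that meets it therefore lies inside it, and maximality gives equality.\<close>

lemma connected_components_of_disjoint_closed:
  assumes I: "finite I" and top: "topspace X = (\<Union>i\<in>I. A i)" and dis: "disjoint_family_on A I"
    and clo: "\<And>i. i \<in> I \<Longrightarrow> closedin X (A i)" and con: "\<And>i. i \<in> I \<Longrightarrow> connectedin X (A i)"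
    and ne: "\<And>i. i \<in> I \<Longrightarrow> A i \<noteq> {}"
  shows "connected_components_of X = A ` I"
proof -
  have comp: "C = A i" if C: "C \<in> connected_components_of X" and i: "i \<in> I" "C \<inter> A i \<noteq> {}" for C i
  proof
    show "A i \<subseteq> C"
      by (rule connected_components_of_maximal[OF C con[OF i(1)]]) (simp add: disjnt_def i(2))
    have "topspace X - A i = (\<Union>j\<in>I - {i}. A j)"
      using i(1) unfolding top by (auto dest: disjoint_family_onD[OF dis])
    moreover have "closedin X (\<Union>j\<in>I - {i}. A j)"
      using I clo by (intro closedin_Union) auto
    ultimately have "openin X (A i)"
      using closedin_subset[OF clo[OF i(1)]] by (simp add: openin_closedin)
    then have "C \<subseteq> A i \<or> disjnt C (A i)"
      by (intro connectedin_clopen_cases[OF connectedin_connected_components_of[OF C] clo[OF i(1)]])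
    then show "C \<subseteq> A i"
      using i(2) by (simp add: disjnt_def)
  qed
  show ?thesis
  proof safe
    fix C assume C: "C \<in> connected_components_of X"
    obtain x where "x \<in> C" using nonempty_connected_components_of[OF C] by blast
    then obtain i where "i \<in> I" "x \<in> A i"
      using connected_components_of_subset[OF C] unfolding top by blast
    then show "C \<in> A ` I" using comp[OF C, of i] \<open>x \<in> C\<close> by (metis IntI empty_iff imageI)
  next
    fix i assume i: "i \<in> I"
    then obtain x where x: "x \<in> A i" using ne[OF i] by blast
    then have "x \<in> topspace X"
      using i top by blast
    then have "x \<in> \<Union>(connected_components_of X)"
      by (simp only: Union_connected_components_of)
    then obtain C where "C \<in> connected_components_of X" "x \<in> C" by blast
    then show "A i \<in> connected_components_of X"
      using comp[of C i] i x by (metis IntI empty_iff)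
  qed
qed

section \<open>Goodness for small residues\<close>

text \<open>Distance at least 1 is a normalisation: within 1/4 of one pole all others are at
  distance at least 3/4, so the bounds below depend on \<open>card I\<close> only.\<close>

locale separated_poles =
  fixes I :: "'i set" and p :: "'i \<Rightarrow> complex"
  assumes finite_I: "finite I"
    and sep: "\<And>i j. i \<in> I \<Longrightarrow> j \<in> I \<Longrightarrow> i \<noteq> j \<Longrightarrow> 1 \<le> norm (p i - p j)"
begin

definition Q :: "complex \<Rightarrow> complex" where
  "Q z = (\<Sum>i\<in>I. 1 / (z - p i))"

definition rest :: "'i \<Rightarrow> complex \<Rightarrow> complex" where
  "rest j z = (\<Sum>i\<in>I - {j}. 1 / (z - p i))"

lemma inj_on_p: "inj_on p I"
  using sep by (force intro!: inj_onI)

lemma Q_split: "j \<in> I \<Longrightarrow> Q z = 1 / (z - p j) + rest j z"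
  unfolding Q_def rest_def using finite_I by (simp add: sum.remove)

text \<open>The bound stays proportional to the distance of the poles, so that it can absorb the
  numerator \<open>p j - p i\<close> in \<open>rest_Lipschitz\<close>.\<close>

lemma norm_diff_pole_ge:
  assumes "i \<in> I" "j \<in> I" "i \<noteq> j" "norm (z - p j) \<le> 1/4"
  shows "3/4 * norm (p j - p i) \<le> norm (z - p i)"
proof -
  have "norm (p j - p i) \<le> norm (z - p i) + norm (z - p j)"
    using norm_triangle_ineq4[of "z - p i" "z - p j"] by simp
  then show ?thesis
    using sep[of j i] assms by auto
qed

lemma norm_diff_pole_ge':
  assumes "i \<in> I" "j \<in> I" "i \<noteq> j" "norm (z - p j) \<le> 1/4"
  shows "3/4 \<le> norm (z - p i)"
  using norm_diff_pole_ge[OF assms] sep[of j i] assms by auto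

lemma norm_rest_le:
  assumes "j \<in> I" "norm (z - p j) \<le> 1/4"
  shows "norm (rest j z) \<le> 4/3 * real (card I)"
proof -
  have "norm (rest j z) \<le> real (card (I - {j})) * (4/3)"
    unfolding rest_def
  proof (rule sum_norm_bound)
    fix i assume "i \<in> I - {j}"
    then have "3/4 \<le> norm (z - p i)"
      using assms norm_diff_pole_ge' by auto
    then show "norm (1 / (z - p i)) \<le> 4/3"
      by (auto simp: norm_divide divide_simps)
  qed
  also have "\<dots> \<le> real (card I) * (4/3)"
    using finite_I by (intro mult_right_mono) (auto intro: card_mono)
  finally show ?thesis by simp
qed

lemma norm_Q_le:
  assumes "\<And>i. i \<in> I \<Longrightarrow> 1/4 \<le> norm (z - p i)"
  shows "norm (Q z) \<le> 4 * real (card I)"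
proof -
  have "norm (Q z) \<le> real (card I) * 4"
    unfolding Q_def
  proof (rule sum_norm_bound)
    fix i assume "i \<in> I"
    then show "norm (1 / (z - p i)) \<le> 4"
      using assms[of i] by (auto simp: norm_divide divide_simps)
  qed
  then show ?thesis by simp
qed

text \<open>Each summand is \<open>1 + (p i - p j) / (z - p i)\<close>, whose variation is
  controlled uniformly in the distance of the poles. This is what makes \<open>K e j\<close>
  starlike.\<close>

lemma rest_Lipschitz:
  assumes j: "j \<in> I" "norm (z - p j) \<le> 1/4" "norm (w - p j) \<le> 1/4"
  shows "norm ((z - p j) * rest j z - (w - p j) * rest j w) \<le> 16/9 * real (card I) * norm (z - w)"
proof -
  have "norm (\<Sum>i\<in>I - {j}. (z - p j) / (z - p i) - (w - p j) / (w - p i))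
      \<le> real (card (I - {j})) * (16/9 * norm (z - w))"
  proof (rule sum_norm_bound)
    fix i assume i: "i \<in> I - {j}"
    define q where "q = norm (p j - p i)"
    have q: "1 \<le> q" "3/4 * q \<le> norm (z - p i)" "3/4 * q \<le> norm (w - p i)"
      using i j sep[of j i] norm_diff_pole_ge[of i j] by (auto simp: q_def)
    then have nz: "z - p i \<noteq> 0" "w - p i \<noteq> 0" by auto
    have "(z - p j) / (z - p i) - (w - p j) / (w - p i)
        = (z - w) * (p j - p i) / ((z - p i) * (w - p i))"
      using nz by (simp add: divide_simps) (simp add: algebra_simps)
    then have "norm ((z - p j) / (z - p i) - (w - p j) / (w - p i))
        = norm (z - w) * q / (norm (z - p i) * norm (w - p i))"
      by (simp add: norm_mult norm_divide q_def)
    also have "\<dots> \<le> norm (z - w) * q / ((3/4 * q) * (3/4 * q))"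
      using q by (intro divide_left_mono mult_mono mult_pos_pos) auto
    also have "\<dots> = 16/9 * norm (z - w) / q"
      using q by (simp add: divide_simps)
    also have "\<dots> \<le> 16/9 * norm (z - w) / 1"
      using q by (intro divide_left_mono) auto
    finally show "norm ((z - p j) / (z - p i) - (w - p j) / (w - p i)) \<le> 16/9 * norm (z - w)"
      by simp
  qed
  also have "\<dots> \<le> real (card I) * (16/9 * norm (z - w))"
    using finite_I by (intro mult_right_mono) (auto intro: card_mono)
  finally show ?thesis
    by (simp add: rest_def sum_distrib_left sum_subtractf mult_ac)
qed

text \<open>
  The part of \<open>\<bar>e * Q\<bar> \<ge> 1\<close> around \<open>p j\<close>; multiplying the condition by \<open>z - p j\<close> keeps it continuous at the pole.
\<close>
definition K :: "real \<Rightarrow> 'i \<Rightarrow> complex set" where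
  "K e j = {z \<in> cball (p j) (1/4). norm (z - p j) \<le> e * norm (1 + (z - p j) * rest j z)}"

lemma mem_K_iff:
  assumes "j \<in> I" "norm (z - p j) \<le> 1/4" "z \<noteq> p j" "0 < e"
  shows "z \<in> K e j \<longleftrightarrow> 1 \<le> norm (of_real e * Q z)"
proof -
  have *: "1 + (z - p j) * rest j z = (z - p j) * Q z"
    using assms by (simp add: Q_split distrib_left)
  have pos: "norm (z - p j) > 0" using assms by simp
  have "e * norm ((z - p j) * Q z) = norm (z - p j) * norm (of_real e * Q z)"
    using assms(4) by (simp add: norm_mult)
  then show ?thesis
    using assms(2) pos unfolding K_def mem_Collect_eq *
    by (simp add: dist_norm norm_minus_commute)
qed

lemma pole_in_K: "0 < e \<Longrightarrow> p j \<in> K e j"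
  by (simp add: K_def)

text \<open>On moving from \<open>z\<close> towards the pole, the left side of the defining
  inequality drops by \<open>(1 - s) * d\<close>, while the right side drops by at most 2/9 of that,
  so the inequality persists.\<close>

lemma starlike_K:
  assumes j: "j \<in> I" and e: "0 < e" "e * real (card I) \<le> 1/8"
  shows "starlike (K e j)"
  unfolding starlike_def
proof (intro bexI[of _ "p j"] ballI subsetI)
  show "p j \<in> K e j" using e by (simp add: pole_in_K)
  fix z w assume z: "z \<in> K e j" and w: "w \<in> closed_segment (p j) z"
  from w obtain s where s: "0 \<le> s" "s \<le> 1" "w = (1 - s) *\<^sub>R p j + s *\<^sub>R z"
    unfolding in_segment by blast
  define d where "d = norm (z - p j)"
  have wp: "w - p j = s *\<^sub>R (z - p j)"
    by (simp add: s scaleR_conv_of_real algebra_simps)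
  have zw: "z - w = (1 - s) *\<^sub>R (z - p j)"
    by (simp add: s scaleR_conv_of_real algebra_simps)
  have nw: "norm (w - p j) = s * d" "norm (z - w) = (1 - s) * d"
    unfolding wp zw d_def using s by simp_all
  have d: "0 \<le> d" "d \<le> 1/4" "d \<le> e * norm (1 + (z - p j) * rest j z)"
    using z by (auto simp: K_def d_def dist_norm norm_minus_commute)
  have "s * d \<le> 1 * d" using s d by (intro mult_right_mono) auto
  then have sd: "s * d \<le> 1/4" using d by simp
  have "norm (1 + (z - p j) * rest j z) - norm (1 + (w - p j) * rest j w)
      \<le> norm ((1 + (z - p j) * rest j z) - (1 + (w - p j) * rest j w))"
    by (rule norm_triangle_ineq2)
  also have "\<dots> = norm ((z - p j) * rest j z - (w - p j) * rest j w)"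
    by simp
  also have "\<dots> \<le> 16/9 * real (card I) * norm (z - w)"
    using j d sd nw by (intro rest_Lipschitz) (auto simp: d_def)
  finally have "e * (norm (1 + (z - p j) * rest j z) - norm (1 + (w - p j) * rest j w))
      \<le> e * (16/9 * real (card I) * norm (z - w))"
    using e by (intro mult_left_mono) auto
  also have "\<dots> = 16/9 * (e * real (card I)) * ((1 - s) * d)"
    by (simp add: nw)
  also have "\<dots> \<le> 16/9 * (1/8) * ((1 - s) * d)"
    using e s d by (intro mult_right_mono mult_left_mono) auto
  also have "\<dots> \<le> 1 * ((1 - s) * d)"
    using s d by (intro mult_right_mono) auto
  finally have "s * d \<le> e * norm (1 + (w - p j) * rest j w)"
    using d by (simp add: algebra_simps)
  then show "w \<in> K e j"
    using nw sd by (simp add: K_def dist_norm norm_minus_commute)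
qed

lemma continuous_on_rest:
  assumes "j \<in> I"
  shows "continuous_on (cball (p j) (1/4)) (rest j)"
proof -
  have "z - p i \<noteq> 0" if "z \<in> cball (p j) (1/4)" "i \<in> I - {j}" for z i
    using norm_diff_pole_ge'[of i j z] that assms by (auto simp: dist_norm norm_minus_commute)
  then show ?thesis
    unfolding rest_def by (intro continuous_intros) auto
qed

lemma compact_K:
  assumes "j \<in> I"
  shows "compact (K e j)"
proof -
  have "closed (K e j)"
    unfolding K_def
    by (intro continuous_on_closed_Collect_le continuous_intros continuous_on_rest assms) simp
  moreover have "bounded (K e j)"
    by (rule bounded_subset[OF bounded_cball[of "p j" "1/4"]]) (auto simp: K_def)
  ultimately show ?thesis
    by (simp add: compact_eq_bounded_closed)
qed

lemma disjoint_K: "disjoint_family_on (K e) I"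
proof (unfold disjoint_family_on_def, intro ballI impI equals0I)
  fix i j z assume ij: "i \<in> I" "j \<in> I" "i \<noteq> j" and z: "z \<in> K e i \<inter> K e j"
  then have "norm (z - p i) \<le> 1/4" "norm (z - p j) \<le> 1/4"
    by (auto simp: K_def dist_norm norm_minus_commute)
  with norm_diff_pole_ge'[OF ij, of z] show False by simp
qed

text \<open>If all poles were at distance at least 1/4, then \<open>norm (e * Q z)\<close> would be
  at most \<open>4 * e * card I\<close>, hence at most 1/2.\<close>

lemma ex_near_pole:
  assumes e: "0 < e" "e * real (card I) \<le> 1/8" and "1 \<le> norm (of_real e * Q z)"
  obtains j where "j \<in> I" "norm (z - p j) < 1/4"
proof -
  have False if far: "\<And>i. i \<in> I \<Longrightarrow> 1/4 \<le> norm (z - p i)"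
  proof -
    have "1 \<le> e * norm (Q z)"
      using assms by (simp add: norm_mult)
    also have "\<dots> \<le> e * (4 * real (card I))"
      using norm_Q_le[OF far] e by (intro mult_left_mono) auto
    finally show False using e by simp
  qed
  then show ?thesis using that by force
qed

lemma mem_Union_K_iff:
  assumes e: "0 < e" "e * real (card I) \<le> 1/8" and "z \<notin> p ` I"
  shows "z \<in> (\<Union>j\<in>I. K e j) \<longleftrightarrow> 1 \<le> norm (of_real e * Q z)"
proof
  assume "z \<in> (\<Union>j\<in>I. K e j)"
  then obtain j where j: "j \<in> I" "z \<in> K e j" by blast
  then have "norm (z - p j) \<le> 1/4" by (auto simp: K_def dist_norm norm_minus_commute)
  then show "1 \<le> norm (of_real e * Q z)"
    using mem_K_iff[of j z e] j assms by auto
next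
  assume *: "1 \<le> norm (of_real e * Q z)"
  then obtain j where "j \<in> I" "norm (z - p j) < 1/4" using e ex_near_pole by blast
  then show "z \<in> (\<Union>j\<in>I. K e j)"
    using * assms mem_K_iff[of j z e] by auto
qed

lemma connected_Compl_Union_K:
  assumes "0 < e" "e * real (card I) \<le> 1/8"
  shows "connected (- (\<Union>j\<in>I. K e j))"
  using assms finite_I
  by (intro connected_Compl_Union_disjoint connected_Compl_starlike compact_K starlike_K disjoint_K)

lemma not_bounded_Compl_Union_K: "\<not> bounded (- (\<Union>j\<in>I. K e j))"
  using finite_I by (intro cobounded_imp_unbounded) (auto intro: compact_imp_bounded compact_K)

section \<open>The rational map with equal residues and its goodness\<close>

definition R_den :: "complex poly" where
  "R_den = (\<Prod>i\<in>I. [:- p i, 1:])"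

text \<open>This is \<open>e\<close> times the derivative of \<open>R_den\<close>, so the quotient
  is \<open>e\<close> times the logarithmic derivative of \<open>R_den\<close>.\<close>

definition R_num :: "real \<Rightarrow> complex poly" where
  "R_num e = smult (of_real e) (\<Sum>j\<in>I. \<Prod>i\<in>I - {j}. [:- p i, 1:])"

definition R :: "real \<Rightarrow> complex option \<Rightarrow> complex option" where
  "R e = rational_eval (R_num e) R_den"

lemma R_den_nonzero: "R_den \<noteq> 0"
  using finite_I by (simp add: R_den_def)

lemma poly_R_den_eq_0_iff: "poly R_den z = 0 \<longleftrightarrow> z \<in> p ` I"
  using finite_I by (auto simp: R_den_def poly_prod)

lemma degree_R_den: "degree R_den = card I"
  unfolding R_den_def by (subst degree_prod_eq_sum_degree) auto

lemma degree_R_num: "degree (R_num e) \<le> card I - 1"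
  unfolding R_num_def
proof (intro order.trans[OF degree_smult_le] degree_sum_le finite_I)
  fix j assume "j \<in> I"
  then show "degree (\<Prod>i\<in>I - {j}. [:- p i, 1:]) \<le> card I - 1"
    by (subst degree_prod_eq_sum_degree) auto
qed

lemma poly_R_num:
  assumes "z \<notin> p ` I"
  shows "poly (R_num e) z = of_real e * Q z * poly R_den z"
proof -
  have "(\<Prod>i\<in>I - {j}. z - p i) = 1 / (z - p j) * (\<Prod>i\<in>I. z - p i)" if "j \<in> I" for j
    using that assms finite_I prod.remove[of I j "\<lambda>i. z - p i"] by auto
  then show ?thesis
    by (simp add: R_num_def R_den_def poly_sum poly_prod Q_def sum_distrib_right)
qed

text \<open>At \<open>p j\<close> only the summand that omits the factor of \<open>p j\<close>
  survives, and it is nonzero because the poles are distinct.\<close>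

lemma poly_R_num_pole:
  assumes j: "j \<in> I" and "0 < e"
  shows "poly (R_num e) (p j) \<noteq> 0"
proof -
  have "(\<Prod>i\<in>I - {k}. p j - p i) = 0" if "k \<in> I - {j}" for k
    using that j finite_I by (intro prod_zero) auto
  then have "(\<Sum>k\<in>I - {j}. \<Prod>i\<in>I - {k}. p j - p i) = 0"
    by (rule sum.neutral[rule_format])
  then have "(\<Sum>k\<in>I. \<Prod>i\<in>I - {k}. p j - p i) = (\<Prod>i\<in>I - {j}. p j - p i)"
    using sum.remove[OF finite_I j, of "\<lambda>k. \<Prod>i\<in>I - {k}. p j - p i"] by simp
  also have "\<dots> \<noteq> 0"
    using finite_I inj_onD[OF inj_on_p] j by (auto simp: prod_zero_iff)
  finally show ?thesis
    using \<open>0 < e\<close> by (simp add: R_num_def poly_sum poly_prod)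
qed

lemma rational_map_R:
  assumes "0 < e"
  shows "rational_map (card I) (R e)"
proof -
  have "coprime (R_num e) R_den"
  proof (rule coprimeI)
    fix c assume c: "c dvd R_num e" "c dvd R_den"
    have "c \<noteq> 0" using c(2) R_den_nonzero by auto
    \<comment> \<open>Over the complex numbers a common divisor without roots is constant, so it
      suffices to exclude common roots.\<close>
    have "poly c z \<noteq> 0" for z
    proof
      assume "poly c z = 0"
      then have "poly (R_num e) z = 0" "poly R_den z = 0"
        using c dvd_trans by (auto simp: poly_eq_0_iff_dvd)
      then show False
        using poly_R_num_pole assms by (auto simp: poly_R_den_eq_0_iff)
    qed
    then have "degree c = 0"
      using alg_closed_imp_poly_has_root[of c] by auto
    then show "is_unit c"
      using \<open>c \<noteq> 0\<close> by (simp add: is_unit_iff_degree)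
  qed
  moreover have "max (degree (R_num e)) (degree R_den) = card I"
    using degree_R_num[of e] by (simp add: degree_R_den)
  ultimately show ?thesis
    unfolding rational_map_def R_def using R_den_nonzero by (intro exI conjI) auto
qed

lemma R_None: "R e None = Some 0"
proof -
  have "coeff (R_num e) (card I) = 0"
  \<comment> \<open>For empty \<open>I\<close> truncated subtraction makes \<open>card I - 1\<close>
    equal to \<open>card I\<close>, so the degree bound says nothing; there the numerator is an
    empty sum.\<close>
  proof (cases "I = {}")
    case False
    then have "degree (R_num e) < card I"
      using degree_R_num[of e] finite_I by (simp add: card_gt_0_iff le_less_trans)
    then show ?thesis by (rule coeff_eq_0)
  next
    case True
    then show ?thesis unfolding R_num_def by simp
  qed
  then show ?thesis
    using degree_R_num[of e] by (simp add: R_def rational_eval_def degree_R_den)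
qed

lemma R_pole: "z \<in> p ` I \<Longrightarrow> R e (Some z) = None"
  by (simp add: R_def rational_eval_def poly_R_den_eq_0_iff)

lemma R_Some: "z \<notin> p ` I \<Longrightarrow> R e (Some z) = Some (of_real e * Q z)"
  by (simp add: R_def rational_eval_def poly_R_den_eq_0_iff poly_R_num)

lemma R_vimage_disk:
  assumes "0 < e" "e * real (card I) \<le> 1/8"
  shows "R e -` sphere_disk = insert None (Some ` (- (\<Union>j\<in>I. K e j)))"
proof (rule set_eqI)
  fix x show "x \<in> R e -` sphere_disk \<longleftrightarrow> x \<in> insert None (Some ` (- (\<Union>j\<in>I. K e j)))"
  proof (cases x)
    case (Some z)
    show ?thesis
    proof (cases "z \<in> p ` I")
      case True
      then show ?thesis
        using pole_in_K[OF assms(1)] R_pole[OF True] by (auto simp: Some)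
    next
      case False
      then show ?thesis
        using mem_Union_K_iff[OF assms False] by (auto simp: Some R_Some image_iff)
    qed
  qed (simp add: R_None)
qed

lemma Compl_insert_None_image_Some: "- insert None (Some ` (- A)) = Some ` A"
proof (rule set_eqI)
  fix x show "x \<in> - insert None (Some ` (- A)) \<longleftrightarrow> x \<in> Some ` A"
    by (cases x) (simp_all add: inj_image_mem_iff image_iff)
qed

text \<open>The sets \<open>K e j\<close> are disjoint, compact and starlike, so they are exactly
  the components of the complement. The rest of the plane is connected and unbounded, so it stays
  connected when infinity is added.\<close>

lemma n_good_R:
  assumes e: "0 < e" "e * real (card I) \<le> 1/8"
  shows "n_good (card I) (R e)"
proof -
  have "R e -` (- sphere_disk) = - insert None (Some ` (- (\<Union>j\<in>I. K e j)))"
    unfolding vimage_Compl R_vimage_disk[OF e] ..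
  also have "\<dots> = Some ` (\<Union>j\<in>I. K e j)"
    by (rule Compl_insert_None_image_Some)
  finally have compl: "R e -` (- sphere_disk) = Some ` (\<Union>j\<in>I. K e j)" .
  define X where "X = subtopology riemann_sphere (Some ` (\<Union>j\<in>I. K e j))"
  have "connected_components_of X = (\<lambda>j. Some ` K e j) ` I"
  proof (rule connected_components_of_disjoint_closed)
    show "topspace X = (\<Union>j\<in>I. Some ` K e j)"
      unfolding X_def by (simp add: image_UN) auto
    show "disjoint_family_on (\<lambda>j. Some ` K e j) I"
      using disjoint_K[of e] unfolding disjoint_family_on_def by (auto simp flip: image_Int)
    fix j assume j: "j \<in> I"
    have sub: "Some ` K e j \<subseteq> Some ` (\<Union>j\<in>I. K e j)"
      using j by blast
    show "closedin X (Some ` K e j)"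
      unfolding X_def using compact_K[OF j] sub
      by (intro closedin_subset_topspace) (auto simp: compact_imp_closed)
    show "connectedin X (Some ` K e j)"
      unfolding X_def connectedin_subtopology
      using connectedin_sphere_image_Some[OF starlike_imp_connected[OF starlike_K[OF j e]]] sub by simp
    show "Some ` K e j \<noteq> {}"
      using pole_in_K[OF e(1), of j] by auto
  qed (use finite_I in simp)
  moreover have "inj_on (\<lambda>j. Some ` K e j) I"
  proof (rule inj_onI)
    fix i j assume ij: "i \<in> I" "j \<in> I" "Some ` K e i = Some ` K e j"
    then have "K e i = K e j" by (simp add: inj_image_eq_iff)
    then show "i = j"
      using disjoint_family_onD[OF disjoint_K[of e] ij(1,2)] pole_in_K[OF e(1), of i] by auto
  qed
  ultimately have "finite (connected_components_of X)" "card (connected_components_of X) = card I"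
    using finite_I by (simp_all add: card_image)
  moreover have "connectedin riemann_sphere (R e -` sphere_disk)"
    unfolding R_vimage_disk[OF e]
    by (intro connectedin_sphere_insert_None connected_Compl_Union_K not_bounded_Compl_Union_K e)
  ultimately show ?thesis
    unfolding n_good_def compl X_def using rational_map_R[OF e(1)] R_None by simp
qed

end

section \<open>Second-order expansion on the boundary\<close>

lemma bounded_mult_comp:
  fixes f g :: "'a \<Rightarrow> complex"
  assumes "bounded (f ` S)" "bounded (g ` S)"
  shows "bounded ((\<lambda>x. f x * g x) ` S)"
proof -
  obtain B C where "\<And>x. x \<in> S \<Longrightarrow> norm (f x) \<le> B" "\<And>x. x \<in> S \<Longrightarrow> norm (g x) \<le> C"
    using assms by (auto simp: bounded_iff)
  then have "norm (f x * g x) \<le> B * C" if "x \<in> S" for x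
    unfolding norm_mult using that norm_ge_zero order_trans by (intro mult_mono) blast+
  then show ?thesis by (auto simp: bounded_iff)
qed

lemma bounded_power_comp:
  fixes f :: "'a \<Rightarrow> complex"
  assumes "bounded (f ` S)"
  shows "bounded ((\<lambda>x. f x ^ n) ` S)"
proof (induction n)
  case 0
  show ?case by (auto simp: bounded_iff)
next
  case (Suc n)
  then show ?case using bounded_mult_comp[OF assms] by simp
qed

lemma bounded_sum_comp:
  fixes f :: "'i \<Rightarrow> 'a \<Rightarrow> complex"
  assumes "\<And>i. i \<in> J \<Longrightarrow> bounded (f i ` S)"
  shows "bounded ((\<lambda>x. \<Sum>i\<in>J. f i x) ` S)"
  using assms
proof (induction J rule: infinite_finite_induct)
  case (insert i J)
  then show ?case by (auto intro: bounded_plus_comp)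
qed (auto simp: bounded_iff)

lemma bounded_const_comp: "bounded ((\<lambda>x. c :: complex) ` S)"
  by (rule bounded_subset[of "{c}"]) auto

lemmas bounded_comps = bounded_plus_comp bounded_minus_comp bounded_mult_comp bounded_power_comp
  bounded_sum_comp bounded_const_comp

text \<open>
  The coefficients \<open>\<gamma>\<close> and \<open>\<eta>\<close> cancel the oscillation of \<open>Re (h * cnj r)\<close> along \<open>\<bar>r\<bar> = 1\<close> up to second order,
  so that only the mean value \<open>Re (\<tau> - 2 * \<gamma> * S)\<close> survives.
\<close>
lemma local_expansion:
  fixes \<epsilon> :: "'a \<Rightarrow> real" and r u \<zeta> s s2 t2 k h :: "'a \<Rightarrow> complex"
    and \<beta> S S1 T T1 \<gamma> \<eta> :: complex and \<tau> :: real
  assumes \<beta>: "Re \<beta> = 0" and \<gamma>: "\<gamma> = - cnj (T - \<beta> * S)" and \<eta>: "\<eta> = - cnj (T1 - \<beta> * S1)"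
    and \<epsilon>: "\<And>x. x \<in> D \<Longrightarrow> 0 < \<epsilon> x" "\<And>x. x \<in> D \<Longrightarrow> \<epsilon> x \<le> 1"
    and r: "\<And>x. x \<in> D \<Longrightarrow> norm (r x) = 1"
    and u: "\<And>x. x \<in> D \<Longrightarrow> r x = u x + \<epsilon> x * s x" "\<And>x. x \<in> D \<Longrightarrow> u x * \<zeta> x = 1"
    and s: "\<And>x. x \<in> D \<Longrightarrow> s x = S + \<epsilon> x * S1 * \<zeta> x + \<epsilon> x ^ 2 * s2 x"
    and h: "\<And>x. x \<in> D \<Longrightarrow> h x = (\<beta> + \<epsilon> x ^ 2 * \<tau>) * u x + \<epsilon> x * \<gamma> * u x ^ 2 + \<epsilon> x ^ 2 * \<eta> * u x ^ 3
              + \<epsilon> x * (T + \<epsilon> x * T1 * \<zeta> x + \<epsilon> x ^ 2 * t2 x) + \<epsilon> x ^ 3 * k x"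
    and bounded: "bounded (u ` D)" "bounded (\<zeta> ` D)" "bounded (s ` D)" "bounded (s2 ` D)"
      "bounded (t2 ` D)" "bounded (k ` D)"
  shows "\<exists>C. \<forall>x\<in>D. Re (h x * cnj (r x)) \<le> \<epsilon> x ^ 2 * (\<tau> - 2 * Re (\<gamma> * S)) + C * \<epsilon> x ^ 3
                 \<and> norm (h x) \<le> C"
proof -
  have b\<epsilon>: "bounded ((\<lambda>x. complex_of_real (\<epsilon> x)) ` D)"
    unfolding bounded_iff using \<epsilon> by (intro exI[of _ 1]) (simp add: abs_of_pos)
  have br: "bounded (r ` D)" "bounded ((\<lambda>x. cnj (r x)) ` D)"
    using r by (auto simp: bounded_iff intro!: exI[of _ 1])
  note bs = bounded b\<epsilon> br bounded_comps
  \<comment> \<open>The exact coefficient of \<open>\<epsilon> x ^ 3\<close> that is left in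
    \<open>h x * cnj (r x)\<close> after the lower-order terms have been rewritten in
    \<open>r x\<close> and its conjugate.\<close>
  define M where "M = (\<lambda>x. cnj (r x) * (- \<beta> * (S1 * \<zeta> x * s x * cnj (r x) + s2 x) - \<tau> * s x
     + \<gamma> * (s x ^ 2 - 2 * r x * (S1 * \<zeta> x + \<epsilon> x * s2 x)) - \<eta> * s x * (u x ^ 2 + u x * r x + r x ^ 2)
     + T1 * \<zeta> x * s x * cnj (r x) + t2 x + k x))"
  have "bounded (M ` D)"
    unfolding M_def by (intro bs)
  then obtain C1 where C1: "\<And>x. x \<in> D \<Longrightarrow> norm (M x) \<le> C1"
    by (auto simp: bounded_iff)
  have "bounded ((\<lambda>x. (\<beta> + \<epsilon> x ^ 2 * \<tau>) * u x + \<epsilon> x * \<gamma> * u x ^ 2 + \<epsilon> x ^ 2 * \<eta> * u x ^ 3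
              + \<epsilon> x * (T + \<epsilon> x * T1 * \<zeta> x + \<epsilon> x ^ 2 * t2 x) + \<epsilon> x ^ 3 * k x) ` D)"
    unfolding of_real_power of_real_mult by (intro bs)
  then obtain C2 where C2: "\<And>x. x \<in> D \<Longrightarrow> norm (h x) \<le> C2"
    by (auto simp: bounded_iff h)
  have "Re (h x * cnj (r x)) \<le> \<epsilon> x ^ 2 * (\<tau> - 2 * Re (\<gamma> * S)) + C1 * \<epsilon> x ^ 3" if x: "x \<in> D" for x
  proof -
    define e \<rho> where "e = complex_of_real (\<epsilon> x)" and "\<rho> = cnj (r x)"
    define X X1 where "X = T - \<beta> * S" and "X1 = T1 - \<beta> * S1"
    have 1: "r x * \<rho> = 1"
      using r[OF x] by (simp add: \<rho>_def complex_norm_square[symmetric])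
    have 2: "r x = u x + e * s x" "u x * \<zeta> x = 1" "s x = S + e * S1 * \<zeta> x + e ^ 2 * s2 x"
      using u[OF x] s[OF x] by (simp_all add: e_def)
    have 3: "h x = (\<beta> + e ^ 2 * \<tau>) * u x + e * \<gamma> * u x ^ 2 + e ^ 2 * \<eta> * u x ^ 3
              + e * (T + e * T1 * \<zeta> x + e ^ 2 * t2 x) + e ^ 3 * k x"
      using h[OF x] by (simp add: e_def)
    have 4: "M x = \<rho> * (- \<beta> * (S1 * \<zeta> x * s x * \<rho> + s2 x) - \<tau> * s x
     + \<gamma> * (s x ^ 2 - 2 * r x * (S1 * \<zeta> x + e * s2 x)) - \<eta> * s x * (u x ^ 2 + u x * r x + r x ^ 2)
     + T1 * \<zeta> x * s x * \<rho> + t2 x + k x)"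
      by (simp add: M_def e_def \<rho>_def)
    \<comment> \<open>Up to first order the reciprocal of \<open>u x\<close> is the conjugate of
      \<open>r x\<close>, since \<open>r x\<close> has modulus 1.\<close>
    have \<zeta>: "\<zeta> x = \<rho> + e * \<zeta> x * s x * \<rho>"
      using 1 2(1,2) by algebra
    \<comment> \<open>The first three powers of \<open>u x\<close> occur in \<open>h x\<close> with
      factors of order 0, 1 and 2 in \<open>e\<close>, so errors of order 3, 2 and 1 suffice
      here.\<close>
    have u1: "u x = r x - e * S - e ^ 2 * S1 * \<rho> - e ^ 3 * (S1 * \<zeta> x * s x * \<rho> + s2 x)"
      using 2(1,3) \<zeta> by algebra
    have u2: "u x ^ 2 = r x ^ 2 - 2 * e * S * r x + e ^ 2 * (s x ^ 2 - 2 * r x * (S1 * \<zeta> x + e * s2 x))"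
      using 2(1,3) by algebra
    have u3: "u x ^ 3 = r x ^ 3 - e * s x * (u x ^ 2 + u x * r x + r x ^ 2)"
      using 2(1) by algebra
    have "h x = \<beta> * u x + e ^ 2 * \<tau> * u x + e * \<gamma> * u x ^ 2 + e ^ 2 * \<eta> * u x ^ 3
              + e * T + e ^ 2 * T1 * \<zeta> x + e ^ 3 * t2 x + e ^ 3 * k x"
      unfolding 3 by algebra
    also have "e ^ 2 * \<tau> * u x = e ^ 2 * \<tau> * r x - e ^ 3 * \<tau> * s x"
      using 2(1) by algebra
    also have "\<beta> * u x = \<beta> * (r x - e * S - e ^ 2 * S1 * \<rho>) - e ^ 3 * \<beta> * (S1 * \<zeta> x * s x * \<rho> + s2 x)"
      using u1 by algebra
    also have "e * \<gamma> * u x ^ 2 = e * \<gamma> * r x ^ 2 - 2 * e ^ 2 * \<gamma> * S * r x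
        + e ^ 3 * \<gamma> * (s x ^ 2 - 2 * r x * (S1 * \<zeta> x + e * s2 x))"
      unfolding u2 by algebra
    also have "e ^ 2 * \<eta> * u x ^ 3 = e ^ 2 * \<eta> * r x ^ 3
        - e ^ 3 * \<eta> * s x * (u x ^ 2 + u x * r x + r x ^ 2)"
      unfolding u3 by algebra
    also have "e ^ 2 * T1 * \<zeta> x = e ^ 2 * T1 * \<rho> + e ^ 3 * T1 * \<zeta> x * s x * \<rho>"
      using \<zeta> by algebra
    finally have hx: "h x * \<rho> = \<beta> + e * (X * \<rho> + \<gamma> * r x) + e ^ 2 * (\<tau> - 2 * \<gamma> * S)
        + e ^ 2 * (X1 * \<rho> ^ 2 + \<eta> * r x ^ 2) + e ^ 3 * M x"
      unfolding 4 X_def X1_def using 1 by algebra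
    \<comment> \<open>The choice of \<open>\<gamma>\<close> and \<open>\<eta>\<close> turns each
      oscillating pair into a number minus its conjugate, which is purely imaginary.\<close>
    have "X * \<rho> + \<gamma> * r x = X * \<rho> - cnj (X * \<rho>)" "X1 * \<rho> ^ 2 + \<eta> * r x ^ 2 = X1 * \<rho> ^ 2 - cnj (X1 * \<rho> ^ 2)"
      by (simp_all add: \<gamma> \<eta> X_def X1_def \<rho>_def algebra_simps)
    moreover have "Re (w - cnj w) = 0" for w :: complex
      by simp
    ultimately have "Re (X * \<rho> + \<gamma> * r x) = 0" "Re (X1 * \<rho> ^ 2 + \<eta> * r x ^ 2) = 0"
      by (simp_all only:)
    then have "Re (h x * \<rho>) = \<epsilon> x ^ 2 * (\<tau> - 2 * Re (\<gamma> * S)) + \<epsilon> x ^ 3 * Re (M x)"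
      unfolding hx e_def of_real_power[symmetric] by (simp add: \<beta> Re_complex_of_real mult.assoc del: of_real_power)
    moreover have "\<epsilon> x ^ 3 * Re (M x) \<le> \<epsilon> x ^ 3 * C1"
      using C1[OF x] complex_Re_le_cmod[of "M x"] \<epsilon>(1)[OF x] by (intro mult_left_mono) auto
    ultimately show ?thesis by (simp add: \<rho>_def mult.commute)
  qed
  then show ?thesis
    using C2 \<epsilon>(1)
    by (intro exI[of _ "max C1 C2"])
       (force intro: order_trans[OF _ add_left_mono] mult_right_mono simp: max.coboundedI2)
qed

section \<open>Imaginary residues and their corrections\<close>

locale phase_perturbation = separated_poles +
  fixes b :: "'a \<Rightarrow> complex"
  assumes Re_b: "Re (b j) = 0"
begin

text \<open>\<open>S j\<close> and \<open>S1 j\<close> are the value and the derivative of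
  \<open>rest j\<close> at \<open>p j\<close>; \<open>T j\<close> and \<open>T1 j\<close> are those
  of the same sum weighted by \<open>b\<close>.\<close>

definition S :: "'a \<Rightarrow> complex" where "S j = (\<Sum>i\<in>I - {j}. 1 / (p j - p i))"
definition S1 :: "'a \<Rightarrow> complex" where "S1 j = - (\<Sum>i\<in>I - {j}. 1 / (p j - p i) ^ 2)"
definition T :: "'a \<Rightarrow> complex" where "T j = (\<Sum>i\<in>I - {j}. b i / (p j - p i))"
definition T1 :: "'a \<Rightarrow> complex" where "T1 j = - (\<Sum>i\<in>I - {j}. b i / (p j - p i) ^ 2)"
definition \<gamma> :: "'a \<Rightarrow> complex" where "\<gamma> j = - cnj (T j - b j * S j)"
definition \<eta> :: "'a \<Rightarrow> complex" where "\<eta> j = - cnj (T1 j - b j * S1 j)"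
definition V :: real where "V = (\<Sum>j\<in>I. Re (\<gamma> j * S j))"
text \<open>The shifts \<open>2 * Re (\<gamma> j * S j)\<close> have total \<open>2 * V\<close>.
  Half of it is spent on an equal negative margin \<open>- V / card I\<close> at every pole, the
  other half remains as the sum of the real residue corrections.\<close>

definition \<tau> :: "'a \<Rightarrow> real" where "\<tau> j = 2 * Re (\<gamma> j * S j) - V / card I"

text \<open>
  \<open>h e / e\<close> has the imaginary residues \<open>b\<close> to leading order. The corrections make \<open>Re (h * cnj R)\<close> equal to
  \<open>- V / card I * e\<^sup>2 + O(e\<^sup>3)\<close> on all of \<open>\<bar>R\<bar> = 1\<close>, while the residues of \<open>h\<close> sum to \<open>V * e\<^sup>3\<close> in real part.
\<close>
definition h :: "real \<Rightarrow> complex \<Rightarrow> complex" where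
  "h e z = e * (\<Sum>i\<in>I. (b i + e ^ 2 * \<tau> i) / (z - p i) + e ^ 2 * \<gamma> i / (z - p i) ^ 2
                       + e ^ 4 * \<eta> i / (z - p i) ^ 3)"

lemma sum_\<tau>: "I \<noteq> {} \<Longrightarrow> (\<Sum>j\<in>I. \<tau> j) = V"
  using finite_I by (simp add: \<tau>_def sum_subtractf V_def flip: sum_distrib_left)

text \<open>This is \<open>local_expansion\<close> over all pairs \<open>(e, z)\<close> at once, so
  that \<open>C\<close> is independent of both. The rescaled coordinate at the pole is
  \<open>\<zeta> = (z - p j) / e\<close>, with reciprocal \<open>u\<close>.\<close>

lemma boundary_estimate_at:
  assumes j: "j \<in> I"
  shows "\<exists>C. \<forall>(e::real) z. 0 < e \<and> e * real (card I) \<le> 1/8 \<and> norm (z - p j) \<le> 1/4 \<and> norm (of_real e * Q z) = 1 \<longrightarrow>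
     Re (h e z * cnj (of_real e * Q z)) \<le> - (V / card I) * e ^ 2 + C * e ^ 3 \<and> norm (h e z) \<le> C"
proof -
  define D where "D = {(e::real, z). 0 < e \<and> e * real (card I) \<le> 1/8 \<and> norm (z - p j) \<le> 1/4 \<and> norm (of_real e * Q z) = 1}"
  have cI: "1 \<le> real (card I)"
    using j finite_I by (simp add: Suc_le_eq card_gt_0_iff) auto
  have e: "0 < e" "e \<le> 1" if "(e, z) \<in> D" for e z
  proof -
    show "0 < e" using that by (simp add: D_def)
    then have "e * 1 \<le> e * real (card I)" using cI by (intro mult_left_mono) auto
    moreover have "e * real (card I) \<le> 1/8" using that by (simp add: D_def)
    ultimately show "e \<le> 1" by linarith
  qed
  have small: "norm (of_real e * rest j z) \<le> 1/6" if "(e, z) \<in> D" for e z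
  proof -
    have D: "0 < e" "e * real (card I) \<le> 1/8" "norm (z - p j) \<le> 1/4"
      using that by (simp_all add: D_def)
    have "norm (of_real e * rest j z) \<le> e * (4/3 * card I)"
      using D norm_rest_le[OF j D(3)] by (simp add: norm_mult)
    then show ?thesis using D by simp
  qed
  \<comment> \<open>At the pole itself division by zero makes \<open>Q z\<close> equal to
    \<open>rest j z\<close>, and \<open>small\<close> contradicts modulus 1.\<close>
  have zp: "z \<noteq> p j" if "(e, z) \<in> D" for e z
    using small[OF that] that by (auto simp: D_def Q_split[OF j])
  define r where "r = (\<lambda>(e, z). complex_of_real e * Q z)"
  define u where "u = (\<lambda>(e, z). complex_of_real e / (z - p j))"
  define \<zeta> where "\<zeta> = (\<lambda>(e, z). (z - p j) / complex_of_real e)"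
  define s where "s = (\<lambda>(e::real, z). rest j z)"
  \<comment> \<open>\<open>s2\<close> and \<open>t2\<close> are second-order Taylor remainders
    divided by \<open>e ^ 2\<close>; \<open>k\<close> collects the corrections at the other
    poles.\<close>
  define s2 where "s2 = (\<lambda>(e, z). \<zeta> (e, z) ^ 2 * (\<Sum>i\<in>I - {j}. 1 / (p j - p i) ^ 2 * (1 / (z - p i))))"
  define t2 where "t2 = (\<lambda>(e, z). \<zeta> (e, z) ^ 2 * (\<Sum>i\<in>I - {j}. b i / (p j - p i) ^ 2 * (1 / (z - p i))))"
  define k where "k = (\<lambda>(e, z). \<Sum>i\<in>I - {j}. \<tau> i * (1 / (z - p i)) + \<gamma> i * (1 / (z - p i)) ^ 2
      + complex_of_real e ^ 2 * \<eta> i * (1 / (z - p i)) ^ 3)"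
  \<comment> \<open>The geometric expansion around \<open>p j\<close>, cut off at second order with
    its exact remainder.\<close>
  have taylor: "c / (z - p i) = c / (p j - p i) - (z - p j) * (c / (p j - p i) ^ 2)
      + (z - p j) ^ 2 * (c / (p j - p i) ^ 2 * (1 / (z - p i)))"
    if "(e, z) \<in> D" "i \<in> I - {j}" for e z i and c :: complex
  proof -
    have "z - p i \<noteq> 0" "p j - p i \<noteq> 0"
      using norm_diff_pole_ge'[of i j z] sep[of j i] that j by (auto simp: D_def)
    then show ?thesis
      by (simp add: divide_simps power2_eq_square) (simp add: algebra_simps)
  qed
  have taylor_sum: "(\<Sum>i\<in>I - {j}. c i / (z - p i)) = (\<Sum>i\<in>I - {j}. c i / (p j - p i))
      + complex_of_real e * (- (\<Sum>i\<in>I - {j}. c i / (p j - p i) ^ 2)) * \<zeta> (e, z)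
      + complex_of_real e ^ 2 * (\<zeta> (e, z) ^ 2 * (\<Sum>i\<in>I - {j}. c i / (p j - p i) ^ 2 * (1 / (z - p i))))"
    if D: "(e, z) \<in> D" for e z and c :: "'a \<Rightarrow> complex"
  proof -
    have z: "z - p j = e * \<zeta> (e, z)"
      using e[OF D] by (simp add: \<zeta>_def)
    have "(\<Sum>i\<in>I - {j}. c i / (z - p i)) = (\<Sum>i\<in>I - {j}. c i / (p j - p i) - (z - p j) * (c i / (p j - p i) ^ 2)
      + (z - p j) ^ 2 * (c i / (p j - p i) ^ 2 * (1 / (z - p i))))"
      by (intro sum.cong refl taylor[OF D])
    also have "\<dots> = (\<Sum>i\<in>I - {j}. c i / (p j - p i)) - (z - p j) * (\<Sum>i\<in>I - {j}. c i / (p j - p i) ^ 2)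
      + (z - p j) ^ 2 * (\<Sum>i\<in>I - {j}. c i / (p j - p i) ^ 2 * (1 / (z - p i)))"
      unfolding sum.distrib sum_subtractf sum_distrib_left ..
    finally show ?thesis
      unfolding z by (simp add: power_mult_distrib mult_ac)
  qed
  have bpole: "bounded ((\<lambda>x. 1 / (snd x - p i)) ` D)" if "i \<in> I - {j}" for i
  proof -
    have "norm (1 / (z - p i)) \<le> 4/3" if "(e, z) \<in> D" for e z
    proof -
      have "3/4 \<le> norm (z - p i)"
        using norm_diff_pole_ge'[of i j z] that j \<open>i \<in> I - {j}\<close> by (auto simp: D_def)
      then show ?thesis by (auto simp: norm_divide divide_simps)
    qed
    then show ?thesis
      unfolding bounded_iff by (intro exI[of _ "4/3"]) force
  qed
  have u_bounds: "5/6 \<le> norm (u x)" "norm (u x) \<le> 7/6" if "x \<in> D" for x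
  proof -
    obtain e z where x: "x = (e, z)" by (cases x)
    have r: "norm (r x) = 1" "r x = u x + of_real e * rest j z"
      using that by (auto simp: x D_def r_def u_def Q_split[OF j] distrib_left)
    show "5/6 \<le> norm (u x)"
      using small[of e z] that norm_triangle_ineq[of "u x" "of_real e * rest j z"] r by (simp add: x)
    show "norm (u x) \<le> 7/6"
      using small[of e z] that norm_diff_ineq[of "u x" "of_real e * rest j z"] r by (simp add: x)
  qed
  have bounded_e: "bounded ((\<lambda>x. complex_of_real (fst x)) ` D)"
    unfolding bounded_iff using e by (intro exI[of _ 1]) (auto simp: abs_of_pos)
  have bounded_u: "bounded (u ` D)"
    unfolding bounded_iff using u_bounds(2) by blast
  have "norm (\<zeta> x) \<le> 6/5" if "x \<in> D" for x
  proof -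
    have "\<zeta> x = 1 / u x" by (simp add: \<zeta>_def u_def split: prod.splits)
    moreover have "1 / norm (u x) \<le> 1 / (5/6)"
      using u_bounds(1)[OF that] by (intro divide_left_mono) auto
    ultimately show ?thesis by (simp add: norm_divide)
  qed
  then have bounded_\<zeta>: "bounded (\<zeta> ` D)"
    unfolding bounded_iff by blast
  have bounded_s: "bounded (s ` D)"
    unfolding bounded_iff
    using norm_rest_le[OF j] by (intro exI[of _ "4/3 * real (card I)"]) (auto simp: s_def D_def)
  note bs = bounded_e bounded_u bounded_\<zeta> bpole bounded_comps
  have "\<exists>C. \<forall>x\<in>D. Re ((\<lambda>(e, z). h e z) x * cnj (r x)) \<le> fst x ^ 2 * (\<tau> j - 2 * Re (\<gamma> j * S j)) + C * fst x ^ 3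
                 \<and> norm ((\<lambda>(e, z). h e z) x) \<le> C"
  proof (rule local_expansion[where \<epsilon> = fst and r = r and h = "\<lambda>(e, z). h e z" and S = "S j" and \<tau> = "\<tau> j" and \<beta> = "b j" and \<gamma> = "\<gamma> j" and \<eta> = "\<eta> j" and T = "T j"
        and ?T1.0 = "T1 j" and ?S1.0 = "S1 j" and u = u and \<zeta> = \<zeta> and s = s and ?s2.0 = s2 and ?t2.0 = t2 and k = k])
    show "\<And>x. x \<in> D \<Longrightarrow> 0 < fst x" "\<And>x. x \<in> D \<Longrightarrow> fst x \<le> 1"
      using e by auto
    show "norm (r x) = 1" if "x \<in> D" for x
      using that by (auto simp: D_def r_def)
    show "r x = u x + complex_of_real (fst x) * s x" if "x \<in> D" for x
      by (auto simp: r_def u_def s_def Q_split[OF j] distrib_left split: prod.splits)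
    show "u x * \<zeta> x = 1" if "x \<in> D" for x
      using that e zp by (cases x) (auto simp: u_def \<zeta>_def)
    show "s x = S j + complex_of_real (fst x) * S1 j * \<zeta> x + complex_of_real (fst x ^ 2) * s2 x" if "x \<in> D" for x
      using taylor_sum[of "fst x" "snd x" "\<lambda>_. 1"] that
      by (cases x) (simp add: s_def s2_def rest_def S_def S1_def)
    show "(\<lambda>(e, z). h e z) x = (b j + complex_of_real ((fst x) ^ 2 * \<tau> j)) * u x + complex_of_real (fst x) * \<gamma> j * u x ^ 2 + complex_of_real (fst x ^ 2) * \<eta> j * u x ^ 3
              + complex_of_real (fst x) * (T j + complex_of_real (fst x) * T1 j * \<zeta> x + complex_of_real (fst x ^ 2) * t2 x) + complex_of_real (fst x ^ 3) * k x" if "x \<in> D" for x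
    proof -
      obtain e z where x: "x = (e, z)" by (cases x)
      define c where "c = complex_of_real e"
      have "h e z = c * ((b j + c ^ 2 * \<tau> j) / (z - p j) + c ^ 2 * \<gamma> j / (z - p j) ^ 2 + c ^ 4 * \<eta> j / (z - p j) ^ 3)
          + c * (\<Sum>i\<in>I - {j}. (b i + c ^ 2 * \<tau> i) / (z - p i) + c ^ 2 * \<gamma> i / (z - p i) ^ 2 + c ^ 4 * \<eta> i / (z - p i) ^ 3)"
        unfolding h_def by (subst sum.remove[OF finite_I j]) (simp add: c_def flip: distrib_left)
      also have "(\<Sum>i\<in>I - {j}. (b i + c ^ 2 * \<tau> i) / (z - p i) + c ^ 2 * \<gamma> i / (z - p i) ^ 2 + c ^ 4 * \<eta> i / (z - p i) ^ 3)
          = (\<Sum>i\<in>I - {j}. b i / (z - p i)) + c ^ 2 * k x"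
        unfolding k_def x sum_distrib_left prod.case sum.distrib[symmetric] c_def[symmetric]
        by (intro sum.cong refl) (simp add: add_divide_distrib distrib_left power_divide power_numeral_reduce mult_ac)
      also have "(\<Sum>i\<in>I - {j}. b i / (z - p i)) = T j + c * T1 j * \<zeta> x + c ^ 2 * t2 x"
        using taylor_sum[of e z b] that by (simp add: x T_def T1_def t2_def c_def)
      \<comment> \<open>The powers of \<open>e\<close> in \<open>h\<close> are those for which the
        corrections become terms of order 1 and 2 in the rescaled coordinate.\<close>
      also have "c * ((b j + c ^ 2 * \<tau> j) / (z - p j) + c ^ 2 * \<gamma> j / (z - p j) ^ 2 + c ^ 4 * \<eta> j / (z - p j) ^ 3)
          = (b j + c ^ 2 * \<tau> j) * u x + c * \<gamma> j * u x ^ 2 + c ^ 2 * \<eta> j * u x ^ 3"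
        by (simp add: x u_def c_def[symmetric] power_divide field_simps power_numeral_reduce)
      finally show ?thesis
        by (simp add: x c_def algebra_simps power_numeral_reduce)
    qed
    show "bounded (s2 ` D)"
      unfolding s2_def case_prod_beta prod.collapse by (intro bs)
    show "bounded (t2 ` D)"
      unfolding t2_def case_prod_beta prod.collapse by (intro bs)
    show "bounded (k ` D)"
      unfolding k_def case_prod_beta by (intro bs)
  qed (use Re_b bounded_u bounded_\<zeta> bounded_s in \<open>simp_all add: \<gamma>_def \<eta>_def\<close>)
  then obtain C where C: "\<And>e z. (e, z) \<in> D \<Longrightarrow> Re (h e z * cnj (r (e, z))) \<le> e ^ 2 * (\<tau> j - 2 * Re (\<gamma> j * S j)) + C * e ^ 3"
    "\<And>e z. (e, z) \<in> D \<Longrightarrow> norm (h e z) \<le> C"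
    by fastforce
  have \<tau>: "\<tau> j - 2 * Re (\<gamma> j * S j) = - (V / card I)"
    by (simp add: \<tau>_def)
  show ?thesis
  proof (intro exI[of _ C] allI impI)
    fix e :: real and z assume *: "0 < e \<and> e * real (card I) \<le> 1/8 \<and> norm (z - p j) \<le> 1/4 \<and> norm (of_real e * Q z) = 1"
    then have "(e, z) \<in> D" by (simp add: D_def)
    from C[OF this] show "Re (h e z * cnj (of_real e * Q z)) \<le> - (V / card I) * e ^ 2 + C * e ^ 3 \<and> norm (h e z) \<le> C"
      unfolding \<tau> by (simp add: r_def mult.commute)
  qed
qed

end

section \<open>A competitor with larger derivative at infinity\<close>

text \<open>For small \<open>d\<close> the linear term dominates, so the sign of
  \<open>Re (v * cnj w)\<close> decides whether the modulus decreases.\<close>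

lemma norm_add_of_real_mult_power2:
  fixes w v :: complex
  shows "norm (w + of_real d * v) ^ 2 = norm w ^ 2 + 2 * d * Re (v * cnj w) + d ^ 2 * norm v ^ 2"
  unfolding cmod_power2 by (simp add: power2_eq_square algebra_simps)

section \<open>Limits and derivatives at infinity\<close>

lemma tendsto_inverse_diff_at_infinity: "((\<lambda>z::complex. 1 / (z - a)) \<longlongrightarrow> 0) at_infinity"
proof -
  have "filterlim (\<lambda>z::complex. - a + z) at_infinity at_infinity"
    by (intro tendsto_add_filterlim_at_infinity[OF tendsto_const] filterlim_ident)
  from filterlim_compose[OF tendsto_inverse_0 this] show ?thesis
    by (simp add: inverse_eq_divide)
qed

lemma tendsto_ratio_at_infinity: "((\<lambda>z::complex. z / (z - a)) \<longlongrightarrow> 1) at_infinity"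
proof -
  have "((\<lambda>z::complex. 1 + a * (1 / (z - a))) \<longlongrightarrow> 1 + a * 0) at_infinity"
    by (intro tendsto_intros tendsto_inverse_diff_at_infinity)
  moreover have "\<forall>\<^sub>F z in at_infinity. 1 + a * (1 / (z - a)) = z / (z - a)"
    unfolding eventually_at_infinity
  proof (intro exI[of _ "norm a + 1"] allI impI)
    fix z :: complex assume "norm a + 1 \<le> norm z"
    then have "z - a \<noteq> 0" by auto
    then show "1 + a * (1 / (z - a)) = z / (z - a)"
      by (simp add: divide_simps)
  qed
  ultimately show ?thesis
    by (simp add: Lim_transform_eventually)
qed

text \<open>Poles of higher order contribute nothing, so the corrections \<open>\<gamma>\<close> and
  \<open>\<eta>\<close> leave the derivative at infinity unchanged.\<close>

lemma tendsto_partial_fraction_at_infinity: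
  fixes a c d f :: complex
  shows "((\<lambda>z. z * (c / (z - a) + d / (z - a) ^ 2 + f / (z - a) ^ 3)) \<longlongrightarrow> c) at_infinity"
proof -
  have "((\<lambda>z. c * (z / (z - a)) + d * (z / (z - a)) * (1 / (z - a)) + f * (z / (z - a)) * (1 / (z - a)) ^ 2)
      \<longlongrightarrow> c * 1 + d * 1 * 0 + f * 1 * 0 ^ 2) at_infinity"
    by (intro tendsto_intros tendsto_inverse_diff_at_infinity tendsto_ratio_at_infinity)
  then show ?thesis
    by (simp add: distrib_left power_divide power_numeral_reduce mult_ac)
qed

context separated_poles
begin

lemma tendsto_Q_at_infinity: "((\<lambda>z. z * Q z) \<longlongrightarrow> of_nat (card I)) at_infinity"
proof -
  have "((\<lambda>z. \<Sum>i\<in>I. z / (z - p i)) \<longlongrightarrow> (\<Sum>i\<in>I. 1)) at_infinity"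
    by (intro tendsto_sum tendsto_ratio_at_infinity)
  then show ?thesis by (simp add: Q_def sum_distrib_left)
qed

lemma eventually_not_pole: "\<forall>\<^sub>F z in at_infinity. z \<notin> p ` I"
proof -
  have "bounded (p ` I)"
    using finite_I by (intro finite_imp_bounded) simp
  then obtain B where B: "\<And>z. z \<in> p ` I \<Longrightarrow> norm z \<le> B"
    unfolding bounded_iff by blast
  then show ?thesis
    unfolding eventually_at_infinity
  proof (intro exI[of _ "B + 1"] allI impI notI)
    fix z assume "B + 1 \<le> norm z" "z \<in> p ` I"
    then show False using B[of z] by simp
  qed
qed

lemma deriv_inf_R: "deriv_inf (the \<circ> R e) = of_real e * of_nat (card I)"
proof -
  have "((\<lambda>z. of_real e * (z * Q z)) \<longlongrightarrow> of_real e * of_nat (card I)) at_infinity"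
    by (intro tendsto_intros tendsto_Q_at_infinity)
  moreover have "\<forall>\<^sub>F z in at_infinity.
      of_real e * (z * Q z) = z * ((the \<circ> R e) (Some z) - (the \<circ> R e) None)"
    using eventually_not_pole by eventually_elim (simp add: R_Some R_None)
  ultimately show ?thesis
    unfolding deriv_inf_def
    by (intro tendsto_Lim trivial_limit_at_infinity) (rule Lim_transform_eventually)
qed

text \<open>Within \<open>e/2\<close> of the pole the product \<open>(z - p j) * rest j z\<close> is
  so small that the right side of the defining inequality is at least \<open>e/2\<close>.\<close>

lemma cball_pole_subset_K:
  assumes j: "j \<in> I" and e: "0 < e" "e * real (card I) \<le> 1/8"
  shows "cball (p j) (e/2) \<subseteq> K e j"
proof
  fix z assume "z \<in> cball (p j) (e/2)"
  then have z: "norm (z - p j) \<le> e/2"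
    by (simp add: dist_norm norm_minus_commute)
  have "1 \<le> real (card I)"
    using j finite_I by (simp add: Suc_le_eq card_gt_0_iff) auto
  then have "e * 1 \<le> e * real (card I)" using e by (intro mult_left_mono) auto
  then have z': "norm (z - p j) \<le> 1/4" using z e by linarith
  have "norm ((z - p j) * rest j z) \<le> e/2 * (4/3 * real (card I))"
    unfolding norm_mult using z norm_rest_le[OF j z'] e by (intro mult_mono) auto
  also have "\<dots> \<le> 1/2" using e by simp
  finally have "1/2 \<le> norm (1 + (z - p j) * rest j z)"
    using norm_diff_ineq[of 1 "(z - p j) * rest j z"] by simp
  then have "e * (1/2) \<le> e * norm (1 + (z - p j) * rest j z)"
    using e by (intro mult_left_mono) auto
  then show "z \<in> K e j"
    using z z' by (simp add: K_def dist_norm norm_minus_commute)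
qed

lemma closure_Compl_Union_K:
  assumes e: "0 < e" "e * real (card I) \<le> 1/8"
  shows "closure (- (\<Union>j\<in>I. K e j)) \<subseteq> - p ` I"
proof -
  have "p j \<in> interior (\<Union>j\<in>I. K e j)" if "j \<in> I" for j
  proof (rule interiorI)
    show "ball (p j) (e/2) \<subseteq> (\<Union>j\<in>I. K e j)"
      using cball_pole_subset_K[OF that e] that ball_subset_cball by blast
  qed (use e in auto)
  then show ?thesis
    unfolding closure_complement by blast
qed

text \<open>The unbounded region is cut off by a disk outside which the limit at infinity already
  gives the bound. All other frontier points satisfy \<open>norm (e * Q w) = 1\<close>.\<close>

lemma maximum_principle:
  assumes e: "0 < e" "e * real (card I) \<le> 1/8"
    and hol: "g holomorphic_on - p ` I" and lim: "(g \<longlongrightarrow> 0) at_infinity"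
    and c: "0 < c" and bound: "\<And>z. z \<notin> p ` I \<Longrightarrow> norm (of_real e * Q z) = 1 \<Longrightarrow> norm (g z) \<le> c"
    and z: "z \<in> - (\<Union>j\<in>I. K e j)"
  shows "norm (g z) \<le> c"
proof -
  define U where "U = - (\<Union>j\<in>I. K e j)"
  have "open U"
    unfolding U_def using finite_I compact_K by (intro open_Compl closed_UN) (auto intro: compact_imp_closed)
  have UQ: "norm (of_real e * Q w) \<le> 1" if "w \<in> U" for w
  proof -
    have "w \<notin> p ` I"
      using that closure_Compl_Union_K[OF e] closure_subset[of U] unfolding U_def by blast
    from mem_Union_K_iff[OF e this] that have "\<not> 1 \<le> norm (of_real e * Q w)"
      unfolding U_def by blast
    then show ?thesis by linarith
  qed
  have clU: "closure U \<subseteq> - p ` I"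
    using closure_Compl_Union_K[OF e] by (simp add: U_def)
  have contQ: "continuous_on (closure U) (\<lambda>z. of_real e * Q z)"
    unfolding Q_def using clU by (intro continuous_intros) auto
  have "\<forall>\<^sub>F w in at_infinity. norm (g w) < c"
    by (rule order_tendstoD(2)[OF tendsto_norm_zero[OF lim] c])
  then obtain B where B: "\<And>w. B \<le> norm w \<Longrightarrow> norm (g w) < c"
    unfolding eventually_at_infinity by blast
  \<comment> \<open>The radius exceeds \<open>norm z\<close>, so that \<open>z\<close> lies in
    \<open>S\<close>, and is at least \<open>B\<close>.\<close>
  define S where "S = U \<inter> ball 0 (max B (norm z + 1))"
  have "open S" using \<open>open U\<close> by (auto simp: S_def)
  have clS: "closure S \<subseteq> closure U" unfolding S_def by (intro closure_mono) auto
  show ?thesis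
  proof (rule maximum_modulus_frontier[where f = g and S = S])
    show "g holomorphic_on interior S"
      using clS clU closure_subset[of S] interior_subset[of S]
      by (intro holomorphic_on_subset[OF hol]) blast
    show "continuous_on (closure S) g"
      using clS clU by (intro continuous_on_subset[OF holomorphic_on_imp_continuous_on[OF hol]]) blast
    show "bounded S" unfolding S_def by (intro bounded_Int) auto
    show "z \<in> S" using z by (simp add: S_def U_def)
    fix w assume "w \<in> frontier S"
    then have w: "w \<in> closure S" "w \<notin> S"
      using \<open>open S\<close> by (auto simp: frontier_def interior_open)
    show "norm (g w) \<le> c"
    proof (cases "w \<in> U")
      case True
      then have "B \<le> norm w" using w unfolding S_def by (simp add: not_less)
      then show ?thesis by (rule less_imp_le[OF B])
    next
      case False
      \<comment> \<open>Outside \<open>U\<close> the modulus of \<open>e * Q\<close> is at least 1,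
        in the closure of \<open>U\<close> at most 1, so the boundary hypothesis applies to
        \<open>w\<close>.\<close>
      have wp: "w \<notin> p ` I" using w clS clU by blast
      then have "1 \<le> norm (of_real e * Q w)"
        using False mem_Union_K_iff[OF e wp] by (auto simp: U_def)
      moreover have "norm (of_real e * Q w) \<le> 1"
        using w clS UQ by (intro continuous_on_closure_norm_le[OF contQ]) auto
      ultimately show ?thesis using bound[OF wp] by simp
    qed
  qed
qed

end

context phase_perturbation
begin

lemma tendsto_h_at_infinity:
  assumes "I \<noteq> {}"
  shows "((\<lambda>z. z * h e z) \<longlongrightarrow> of_real e * ((\<Sum>i\<in>I. b i) + of_real (e ^ 2 * V))) at_infinity"
proof -
  have "((\<lambda>z. e * (\<Sum>i\<in>I. z * ((b i + e ^ 2 * \<tau> i) / (z - p i) + e ^ 2 * \<gamma> i / (z - p i) ^ 2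
                       + e ^ 4 * \<eta> i / (z - p i) ^ 3))) \<longlongrightarrow> of_real e * (\<Sum>i\<in>I. b i + e ^ 2 * \<tau> i)) at_infinity"
    by (intro tendsto_intros tendsto_sum tendsto_partial_fraction_at_infinity)
  also have "(\<Sum>i\<in>I. b i + e ^ 2 * \<tau> i) = (\<Sum>i\<in>I. b i) + of_real (e ^ 2 * V)"
    by (simp add: sum.distrib sum_\<tau>[OF assms, symmetric] sum_distrib_left)
  finally show ?thesis
    by (simp add: h_def sum_distrib_left mult_ac)
qed

text \<open>The constants are chosen in turn: \<open>C\<close> from the boundary estimates, then
  \<open>e\<close> so that the cubic error takes at most half of the margin, then \<open>d\<close>
  so that the quadratic term takes half of the linear gain.\<close>

lemma ex_small_perturbation:
  assumes "I \<noteq> {}" "0 < V"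
  obtains e d c :: real where "0 < e" "e * real (card I) \<le> 1/8" "0 < d" "0 < c" "c < 1"
    "\<And>z. norm (of_real e * Q z) = 1 \<Longrightarrow> norm (of_real e * Q z + of_real d * h e z) \<le> c"
proof -
  define m where "m = V / card I"
  have n: "0 < real (card I)"
    using assms finite_I by (simp add: card_gt_0_iff)
  have m: "0 < m" using n assms by (simp add: m_def)
  have "\<forall>j\<in>I. \<exists>C. \<forall>(e::real) z. 0 < e \<and> e * real (card I) \<le> 1/8 \<and> norm (z - p j) \<le> 1/4 \<and>
      norm (of_real e * Q z) = 1 \<longrightarrow>
      Re (h e z * cnj (of_real e * Q z)) \<le> - m * e ^ 2 + C * e ^ 3 \<and> norm (h e z) \<le> C"
    unfolding m_def by (intro ballI boundary_estimate_at)
  from bchoice[OF this] obtain C' where C': "\<forall>j\<in>I. \<forall>(e::real) z. 0 < e \<and> e * real (card I) \<le> 1/8 \<and>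
      norm (z - p j) \<le> 1/4 \<and> norm (of_real e * Q z) = 1 \<longrightarrow>
      Re (h e z * cnj (of_real e * Q z)) \<le> - m * e ^ 2 + C' j * e ^ 3 \<and> norm (h e z) \<le> C' j"
    ..
  \<comment> \<open>Absolute values make the sum dominate every \<open>C' j\<close>; the added
    \<open>m + 1\<close> makes it positive.\<close>
  define C where "C = (\<Sum>j\<in>I. \<bar>C' j\<bar>) + m + 1"
  have "0 \<le> (\<Sum>j\<in>I. \<bar>C' j\<bar>)" by (intro sum_nonneg) auto
  then have C: "0 < C" unfolding C_def using m by linarith
  have C'C: "C' j \<le> C" if "j \<in> I" for j
    using member_le_sum[OF that, of "\<lambda>j. \<bar>C' j\<bar>"] finite_I m by (simp add: C_def)
  define e where "e = min (1 / (8 * card I)) (m / (2 * C))"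
  have e0: "0 < e" using n m C by (simp add: e_def)
  have "e \<le> 1 / (8 * card I)" by (simp add: e_def)
  then have e1: "e * real (card I) \<le> 1/8" using n by (simp add: field_simps)
  have "e \<le> m / (2 * C)" by (simp add: e_def)
  then have e2: "C * e \<le> m / 2" using C by (simp add: field_simps)
  have bd: "Re (h e z * cnj (of_real e * Q z)) \<le> - (m / 2) * e ^ 2 \<and> norm (h e z) \<le> C"
    if z: "norm (of_real e * Q z) = 1" for z
  proof -
    obtain j where j: "j \<in> I" "norm (z - p j) < 1/4"
      by (rule ex_near_pole[OF e0 e1, of z]) (use z in auto)
    have 1: "Re (h e z * cnj (of_real e * Q z)) \<le> - m * e ^ 2 + C' j * e ^ 3" "norm (h e z) \<le> C' j"
      using bspec[OF C' j(1)] e0 e1 j(2) z by auto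
    have "C' j * e ^ 3 \<le> C * e ^ 3"
      using C'C[OF j(1)] e0 by (intro mult_right_mono) auto
    also have "\<dots> = (C * e) * e ^ 2" by (simp add: power_numeral_reduce)
    also have "\<dots> \<le> (m / 2) * e ^ 2" using e2 by (intro mult_right_mono) auto
    finally show ?thesis using 1 C'C[OF j(1)] by simp
  qed
  \<comment> \<open>The solution of \<open>d ^ 2 * C ^ 2 = d * m * e ^ 2 / 2\<close>, half of the
    linear gain \<open>d * m * e ^ 2\<close>.\<close>
  define d where "d = m * e ^ 2 / (2 * C ^ 2)"
  \<comment> \<open>The maximum with 1/2 keeps \<open>c\<close> positive, as
    \<open>maximum_principle\<close> requires.\<close>
  define c where "c = max (1/2) (sqrt (1 - d * m * e ^ 2 / 2))"
  have d: "0 < d" using m e0 C by (simp add: d_def)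
  have "norm (of_real e * Q z + of_real d * h e z) \<le> c" if z: "norm (of_real e * Q z) = 1" for z
  proof -
    have "norm (of_real e * Q z + of_real d * h e z) ^ 2
        = 1 + 2 * d * Re (h e z * cnj (of_real e * Q z)) + d ^ 2 * norm (h e z) ^ 2"
      unfolding norm_add_of_real_mult_power2 z by simp
    also have "\<dots> \<le> 1 + 2 * d * (- (m / 2) * e ^ 2) + d ^ 2 * C ^ 2"
      using bd[OF z] d by (intro add_mono mult_left_mono power_mono) auto
    also have "d ^ 2 * C ^ 2 = d * m * e ^ 2 / 2"
      using C by (simp add: d_def power2_eq_square)
    finally have "norm (of_real e * Q z + of_real d * h e z) ^ 2 \<le> 1 - d * m * e ^ 2 / 2"
      by (simp add: field_simps)
    from real_le_rsqrt[OF this] show ?thesis by (simp add: c_def)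
  qed
  moreover have "0 < c" "c < 1"
    using d m e0 by (auto simp: c_def)
  ultimately show ?thesis using that[OF e0 e1 d] by simp
qed

theorem ex_not_rational_ahlfors:
  assumes "I \<noteq> {}" "0 < V"
  obtains e where "0 < e" "e * real (card I) \<le> 1/8" "\<not> rational_ahlfors_function (card I) (R e)"
proof -
  obtain e d c :: real where e: "0 < e" "e * real (card I) \<le> 1/8" and d: "0 < d" and c: "0 < c" "c < 1"
    and bound: "\<And>z. norm (of_real e * Q z) = 1 \<Longrightarrow> norm (of_real e * Q z + of_real d * h e z) \<le> c"
    by (rule ex_small_perturbation[OF assms]) (rule that, assumption+)
  define X where "X = R e -` sphere_disk"
  define f where "f z = of_real e * Q z + of_real d * h e z" for z
  define g where "g = (\<lambda>x. case x of None \<Rightarrow> 0 | Some z \<Rightarrow> f z)"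
  define L where "L = of_real e * of_nat (card I) + of_real d * (of_real e * ((\<Sum>i\<in>I. b i) + of_real (e ^ 2 * V)))"
  have "((\<lambda>z. of_real e * (z * Q z) + of_real d * (z * h e z)) \<longlongrightarrow> L) at_infinity"
    unfolding L_def by (intro tendsto_intros tendsto_Q_at_infinity tendsto_h_at_infinity assms)
  then have lim: "((\<lambda>z. z * f z) \<longlongrightarrow> L) at_infinity"
    by (simp add: f_def distrib_left mult_ac)
  have "((\<lambda>z. (z * f z) * (1 / (z - 0))) \<longlongrightarrow> L * 0) at_infinity"
    by (intro tendsto_intros lim tendsto_inverse_diff_at_infinity)
  moreover have "\<forall>\<^sub>F z in at_infinity. (z * f z) * (1 / (z - 0)) = f z"
    unfolding eventually_at_infinity by (intro exI[of _ 1]) auto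
  ultimately have lim0: "(f \<longlongrightarrow> 0) at_infinity"
    by (simp add: Lim_transform_eventually)
  have hol: "f holomorphic_on - p ` I"
    unfolding f_def[abs_def] Q_def h_def by (intro holomorphic_intros) auto
  have X: "X = insert None (Some ` (- (\<Union>j\<in>I. K e j)))"
    unfolding X_def by (rule R_vimage_disk[OF e])
  have XI: "z \<notin> p ` I" if "Some z \<in> X" for z
    using that R_pole[of z e] by (auto simp: X_def)
  have "ahlfors_admissible X g"
    unfolding ahlfors_admissible_def sphere_holomorphic_on_def
  proof (intro conjI ballI)
    show "(g \<circ> Some) holomorphic_on Some -` X"
      unfolding g_def comp_def option.case by (rule holomorphic_on_subset[OF hol]) (use XI in blast)
    \<comment> \<open>This is \<open>1 / (z - p i)\<close> in the coordinate
      \<open>w = 1 / z\<close>. It is also regular at \<open>w = 0\<close>, so \<open>F\<close>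
      represents \<open>g\<close> in the chart around infinity.\<close>
    define s where "s = (\<lambda>i w. w / (1 - p i * w))"
    define F where "F = (\<lambda>w. of_real e * (\<Sum>i\<in>I. s i w) + of_real d * (of_real e * (\<Sum>i\<in>I.
         (b i + e ^ 2 * \<tau> i) * s i w + e ^ 2 * \<gamma> i * s i w ^ 2 + e ^ 4 * \<eta> i * s i w ^ 3)))"
    have nz: "1 - p i * w \<noteq> 0" if "w \<in> chart_inf -` X" "i \<in> I" for w i
    proof (cases "w = 0")
      case False
      then have "Some (inverse w) \<in> X" using that(1) by (simp add: chart_inf_def)
      from XI[OF this] that(2) have "inverse w \<noteq> p i" by blast
      then show ?thesis using inverse_unique[of w "p i"] by (auto simp: mult.commute)
    qed simp
    define W where "W = {w. \<forall>i\<in>I. 1 - p i * w \<noteq> 0}"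
    have "s i holomorphic_on W" if "i \<in> I" for i
      unfolding s_def by (intro holomorphic_intros) (use that in \<open>simp add: W_def\<close>)
    then have "F holomorphic_on W"
      unfolding F_def by (intro holomorphic_on_add holomorphic_on_mult holomorphic_on_sum
          holomorphic_on_power holomorphic_on_const)
    then have "F holomorphic_on chart_inf -` X"
      by (rule holomorphic_on_subset) (unfold W_def, use nz in blast)
    moreover have "F w = (g \<circ> chart_inf) w" if "w \<in> chart_inf -` X" for w
    proof (cases "w = 0")
      case True
      then show ?thesis by (simp add: g_def chart_inf_def F_def s_def)
    next
      case False
      have s: "s i w = 1 / (inverse w - p i)" for i
      proof -
        have "inverse w - p i = (1 - p i * w) / w"
          using False by (simp add: diff_divide_distrib inverse_eq_divide)
        then show ?thesis by (simp add: s_def)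
      qed
      have "F w = f (inverse w)"
        unfolding F_def f_def Q_def h_def s by (simp add: power_divide)
      then show ?thesis using False by (simp add: g_def chart_inf_def)
    qed
    ultimately show "(g \<circ> chart_inf) holomorphic_on chart_inf -` X"
      by (rule holomorphic_transform)
    show "g None = 0" by (simp add: g_def)
    fix x assume x: "x \<in> X"
    show "norm (g x) < 1"
    proof (cases x)
      case (Some z)
      then have "z \<in> - (\<Union>j\<in>I. K e j)" using x by (auto simp: X)
      from maximum_principle[OF e hol lim0 c(1) _ this] bound[folded f_def]
      have "norm (f z) \<le> c" by blast
      then show ?thesis using c by (simp add: Some g_def)
    qed (simp add: g_def)
  qed
  moreover have "deriv_inf g = L"
    unfolding deriv_inf_def by (rule tendsto_Lim) (use lim in \<open>simp_all add: g_def trivial_limit_at_infinity\<close>)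
  \<comment> \<open>The sum of the \<open>b i\<close> is imaginary, so the gain in real part is
    \<open>d * e ^ 3 * V\<close>.\<close>
  moreover have "Re L > Re (deriv_inf (the \<circ> R e))"
    using d e assms by (simp add: L_def deriv_inf_R Re_b)
  ultimately have "\<not> ahlfors_function X (the \<circ> R e)"
    unfolding ahlfors_function_def by auto
  then show ?thesis
    using that e by (simp add: rational_ahlfors_function_def X_def)
qed

end

section \<open>A configuration with one non-real pole\<close>

text \<open>
  One pole lies off the line of the others, and only its residue is rotated: then \<open>V\<close> is a sum over pairs of
  real poles, all of whose terms have the same sign.
\<close>
definition pole :: "nat \<Rightarrow> nat \<Rightarrow> complex" where
  "pole n j = (if j < n then of_nat j else \<i>)"

text \<open>\<open>V\<close> is real-linear in \<open>b\<close>; the sign of \<open>- \<i>\<close>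
  is the one that makes it positive.\<close>

definition phase :: "nat \<Rightarrow> nat \<Rightarrow> complex" where
  "phase n j = (if j < n then 0 else - \<i>)"

lemma norm_of_nat_diff_ge_1:
  assumes "i \<noteq> j"
  shows "1 \<le> norm (of_nat i - of_nat j :: complex)"
proof -
  have "norm (of_nat i - of_nat j :: complex) = norm (of_int (int i - int j) :: complex)"
    by simp
  also have "\<dots> = \<bar>real_of_int (int i - int j)\<bar>"
    by (rule norm_of_int)
  finally show ?thesis
    using assms by linarith
qed

lemma norm_of_nat_diff_ii_ge_1: "1 \<le> norm (of_nat i - \<i>)" "1 \<le> norm (\<i> - of_nat i)"
  using abs_Im_le_cmod[of "of_nat i - \<i>"] abs_Im_le_cmod[of "\<i> - of_nat i"] by auto

interpretation example: phase_perturbation "{1..n}" "pole n" "phase n" for n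
proof
  show "finite {1..n}" by simp
  show "1 \<le> norm (pole n i - pole n j)" if "i \<in> {1..n}" "j \<in> {1..n}" "i \<noteq> j" for i j
    using that norm_of_nat_diff_ge_1[OF that(3)] norm_of_nat_diff_ii_ge_1 by (auto simp: pole_def)
  show "Re (phase n j) = 0" for j
    by (simp add: phase_def)
qed

text \<open>Exchanging \<open>j\<close> and \<open>k\<close> and averaging turns the summands into
  difference quotients of the decreasing function \<open>w\<close>. These are negative off the
  diagonal and zero on it, by division by zero.\<close>

lemma sum_strict_antimono_quotients_neg:
  fixes w :: "nat \<Rightarrow> real"
  assumes w: "\<And>i j. i < j \<Longrightarrow> w j < w i" and A: "finite A" "a \<in> A" "b \<in> A" "a < b"
  shows "(\<Sum>j\<in>A. \<Sum>k\<in>A. w j / (real j - real k)) < 0"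
proof -
  have "(\<Sum>j\<in>A. \<Sum>k\<in>A. w j / (real j - real k)) = (\<Sum>j\<in>A. \<Sum>k\<in>A. w k / (real k - real j))"
    by (rule sum.swap)
  then have "2 * (\<Sum>j\<in>A. \<Sum>k\<in>A. w j / (real j - real k))
      = (\<Sum>j\<in>A. \<Sum>k\<in>A. w j / (real j - real k) + w k / (real k - real j))"
    by (simp add: sum.distrib)
  also have "\<dots> < (\<Sum>j\<in>A. 0)"
  proof (rule sum_strict_mono_ex1[OF A(1)])
    have le: "w j / (real j - real k) + w k / (real k - real j) \<le> 0"
      and less: "j < k \<Longrightarrow> w j / (real j - real k) + w k / (real k - real j) < 0" for j k
    proof -
      have eq: "w j / (real j - real k) + w k / (real k - real j) = (w j - w k) / (real j - real k)"
        by (simp add: diff_divide_distrib) (metis minus_diff_eq minus_divide_right)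
      show "j < k \<Longrightarrow> w j / (real j - real k) + w k / (real k - real j) < 0"
        unfolding eq using w[of j k] by (intro divide_pos_neg) auto
      show "w j / (real j - real k) + w k / (real k - real j) \<le> 0"
        unfolding eq using w[of j k] w[of k j]
        by (cases j k rule: linorder_cases) (auto intro: divide_nonneg_neg divide_nonpos_pos less_imp_le)
    qed
    show "\<forall>j\<in>A. (\<Sum>k\<in>A. w j / (real j - real k) + w k / (real k - real j)) \<le> 0"
      using le by (intro ballI sum_nonpos)
    have "(\<Sum>k\<in>A. w a / (real a - real k) + w k / (real k - real a)) < (\<Sum>k\<in>A. 0)"
      using le A less[OF A(4)] by (intro sum_strict_mono_ex1) auto
    then show "\<exists>j\<in>A. (\<Sum>k\<in>A. w j / (real j - real k) + w k / (real k - real j)) < 0"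
      using A by auto
  qed
  finally show ?thesis by simp
qed

text \<open>The pole \<i> itself contributes nothing, since \<open>\<gamma> * S\<close> is \<i>
  times a squared modulus there. At a real pole the interaction with \<i> is imaginary too, and what
  remains is a sum over real poles with the decreasing weight \<open>w\<close>.\<close>

lemma example_V_pos:
  assumes n: "3 \<le> n"
  shows "0 < example.V n"
proof -
  define A where "A = {1..<n}"
  define w where "w j = 1 / (real j ^ 2 + 1)" for j :: nat
  have A_fin: "finite A" by (simp add: A_def)
  have \<gamma>n: "Re (example.\<gamma> n n * example.S n n) = 0"
  proof -
    have T: "example.T n n = 0"
      unfolding example.T_def by (intro sum.neutral) (auto simp: phase_def)
    have "example.\<gamma> n n * example.S n n = \<i> * (example.S n n * cnj (example.S n n))"
      unfolding example.\<gamma>_def T by (simp add: phase_def)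
    then show ?thesis
      by (simp only: complex_norm_square[symmetric]) simp
  qed
  have \<gamma>: "Re (example.\<gamma> n j * example.S n j) = - (\<Sum>k\<in>A. w j / (real j - real k))" if j: "j \<in> A" for j
  proof -
    have jn: "j < n" "j \<noteq> n" "{1..n} - {j} = insert n (A - {j})" "n \<notin> A - {j}"
      using j by (auto simp: A_def)
    have T: "example.T n j = - \<i> / (of_nat j - \<i>)"
      unfolding example.T_def jn(3) using jn A_fin
      by (subst sum.insert) (auto simp: phase_def pole_def A_def intro!: sum.neutral)
    have \<gamma>j: "example.\<gamma> n j = - \<i> / (of_nat j + \<i>)"
      unfolding example.\<gamma>_def T using jn by (simp add: phase_def)
    have "example.S n j = 1 / (of_nat j - \<i>) + (\<Sum>k\<in>A - {j}. 1 / (of_nat j - of_nat k))"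
      unfolding example.S_def jn(3) using jn A_fin
      by (subst sum.insert) (auto simp: pole_def A_def intro!: sum.cong)
    \<comment> \<open>The term for \<open>k = j\<close> may be added, since division by zero gives
      0.\<close>
    also have "(\<Sum>k\<in>A - {j}. 1 / (of_nat j - of_nat k)) = (\<Sum>k\<in>A. 1 / (of_nat j - of_nat k) :: complex)"
      by (subst sum.remove[OF A_fin j]) simp
    also have "\<dots> = of_real (\<Sum>k\<in>A. 1 / (real j - real k))"
      by simp
    finally have S: "example.S n j = 1 / (of_nat j - \<i>) + of_real (\<Sum>k\<in>A. 1 / (real j - real k))" .
    have nz: "of_nat j + \<i> \<noteq> 0" "of_nat j - \<i> \<noteq> 0"
      by (auto simp: complex_eq_iff)
    have "(of_nat j + \<i>) * (of_nat j - \<i>) = of_real (real j ^ 2 + 1)"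
      by (simp add: algebra_simps power2_eq_square)
    then have 1: "- \<i> / (of_nat j + \<i>) * (1 / (of_nat j - \<i>)) = - \<i> * of_real (w j)"
      by (simp add: w_def)
    have 2: "Re (- \<i> / (of_nat j + \<i>)) = - w j"
      by (simp add: Re_divide w_def power2_eq_square)
    have 3: "Re (z * of_real x) = Re z * x" for z x
      by simp
    have "Re (example.\<gamma> n j * example.S n j) = - w j * (\<Sum>k\<in>A. 1 / (real j - real k))"
      unfolding \<gamma>j S distrib_left 1 by (simp only: plus_complex.sel 3 2) simp
    also have "\<dots> = - (\<Sum>k\<in>A. w j / (real j - real k))"
      by (simp add: sum_distrib_left sum_negf)
    finally show ?thesis .
  qed
  have A: "n \<in> {1..n}" "{1..n} - {n} = A"
    using n by (auto simp: A_def)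
  have "example.V n = (\<Sum>j\<in>A. Re (example.\<gamma> n j * example.S n j))"
    unfolding example.V_def sum.remove[OF finite_atLeastAtMost A(1)] \<gamma>n A(2) by (rule add_0)
  also have "\<dots> = (\<Sum>j\<in>A. - (\<Sum>k\<in>A. w j / (real j - real k)))"
    by (intro sum.cong refl \<gamma>)
  also have "\<dots> = - (\<Sum>j\<in>A. \<Sum>k\<in>A. w j / (real j - real k))"
    by (rule sum_negf)
  finally have V: "example.V n = - (\<Sum>j\<in>A. \<Sum>k\<in>A. w j / (real j - real k))" .
  have w: "w j < w i" if "i < j" for i j
    using power_strict_mono[of "real i" "real j" 2] that unfolding w_def
    by (intro divide_strict_left_mono mult_pos_pos add_nonneg_pos) auto
  \<comment> \<open>Here \<open>3 \<le> n\<close> enters: it provides the two real poles 1 and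
    2.\<close>
  have "(\<Sum>j\<in>A. \<Sum>k\<in>A. w j / (real j - real k)) < 0"
    by (rule sum_strict_antimono_quotients_neg[OF w A_fin, where a = 1 and b = 2]) (use n in \<open>auto simp: A_def\<close>)
  then show ?thesis unfolding V by linarith
qed

theorem theorem6p9:
  fixes n :: nat
  assumes "n \<ge> 3"
  shows "\<exists>(R :: complex option \<Rightarrow> complex option) (a :: nat \<Rightarrow> real) (p :: nat \<Rightarrow> complex).
           n_good n R \<and>
           inj_on p {1..n} \<and>
           (\<forall>j\<in>{1..n}. a j > 0) \<and>
           (\<forall>z. z \<notin> p ` {1..n} \<longrightarrow>
              R (Some z) = Some (\<Sum>j=1..n. complex_of_real (a j) / (z - p j))) \<and>
           \<not> rational_ahlfors_function n R"
proof -
  have "{1..n} \<noteq> {}" using assms by simp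
  then obtain e where e: "0 < e" "e * real (card {1..n}) \<le> 1/8"
    and not_ahlfors: "\<not> rational_ahlfors_function (card {1..n}) (example.R n e)"
    by (rule example.ex_not_rational_ahlfors[OF _ example_V_pos[OF assms]])
  \<comment> \<open>All residues equal \<open>e\<close>; the poles are the integers from 1 to
    \<open>n - 1\<close> together with \<i>.\<close>
  show ?thesis
  proof (intro exI conjI)
    show "n_good n (example.R n e)"
      using example.n_good_R[OF e] by simp
    show "inj_on (pole n) {1..n}"
      by (rule example.inj_on_p)
    show "\<forall>j\<in>{1..n}. (\<lambda>_. e) j > 0"
      using e by simp
    show "\<forall>z. z \<notin> pole n ` {1..n} \<longrightarrow>
        example.R n e (Some z) = Some (\<Sum>j=1..n. complex_of_real ((\<lambda>_. e) j) / (z - pole n j))"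
    proof (intro allI impI)
      fix z assume "z \<notin> pole n ` {1..n}"
      then show "example.R n e (Some z) = Some (\<Sum>j=1..n. complex_of_real ((\<lambda>_. e) j) / (z - pole n j))"
        unfolding example.R_Some[OF \<open>z \<notin> _\<close>] example.Q_def by (simp add: sum_distrib_left)
    qed
    show "\<not> rational_ahlfors_function n (example.R n e)"
      using not_ahlfors by simp
  qed
qed

end
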